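(* Let $I_1:T\rightsquigarrow T_1$ and $I_2:T\rightsquigarrow T_2$ be open interpretations and let $J_1:T_1\rightsquigarrow T'$, $J_2:T_2\rightsquigarrow T'$ form a pushout of $(I_1,I_2)$ in the category $\mathbf{Int}$. If $\phi_1\in\mathrm{Hom}^+(\mathcal A[T_1],\mathbb R)$ and $\phi_2\in\mathrm{Hom}^+(\mathcal A[T_2],\mathbb R)$ satisfy $\phi_1^{I_1}=\phi_2^{I_2}$, then there exists $\psi\in\mathrm{Hom}^+(\mathcal A[T'],\mathbb R)$ with $\psi^{J_1}=\phi_1$ and $\psi^{J_2}=\phi_2$.
   Context: All languages are finite relational; predicates $P$ have arity $k(P)\ge1$. A canonical theory over $\mathcal L$ is a universal theory containing, for each $P\in\mathcal L$, the axiom that $P(x_1,\dots,x_{k(P)})$ fails whenever two $x_i$ coincide. $\mathcal M[T]$: isomorphism classes of finite models of $T$. $\mathrm{Hom}^+(\mathcal A[T],\mathbb R)$: functions $\phi:\mathcal M[T]\to[0,1]$, $\phi(M)=\lim_n p(M,N_n)$ for finite models $N_n$ of $T$ of strictly increasing size ($p(M,N)$ = probability a random $|M|$-subset of $V(N)$ induces a copy of $M$). An open interpretation $I:T_1\rightsquigarrow T_2$ assigns to each predicate $P$ of $T_1$ a quantifier-free formula $I(P)(x_1,\dots,x_{k(P)})$ of the language of $T_2$ such that for every model $K$ of $T_2$ the structure $I(K)$ on $V(K)$ with $R_P(I(K))=\{\alpha:K\models I(P)(\alpha)\}$ is a model of $T_1$ (equivalently, $T_2$ proves the translation of every axiom of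 $T_1$); $\phi^I(M)=\sum\{\phi(N):N\in\mathcal M_{|M|}[T_2],I(N)\cong M\}$. $\mathbf{Int}$ is the category whose objects are canonical theories and whose morphisms $T_1\to T_2$ are open interpretations $T_1\rightsquigarrow T_2$, two interpretations being identified when $T_2$ proves the corresponding formulas equivalent, with composition by substitution. A pushout of $(I_1,I_2)$ is a pair $J_1,J_2$ with $J_1\circ I_1=J_2\circ I_2$ satisfying the usual universal property. An example of a pushout: $T'$ obtained from the disjoint union $T_1\cup T_2$ by adding the axioms $\forall\vec x\,(I_1(P)(\vec x)\equiv I_2(P)(\vec x))$ for every predicate $P$ of $T$, with $J_1,J_2$ acting identically on the languages of $T_1,T_2$. *)

theory Defs
  imports Complex_Main "HOL-Library.FuncSet"
begin

text \<open>
  Predicate symbols, variables and elements of models are all natural numbers. Since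
  languages are finite, every language is a renaming of one of this kind, and every finite model is
  isomorphic to one on a set of natural numbers.
\<close>

datatype form =
    Falsum
  | Eq nat nat
  | Rel nat "nat list"
  | Neg form
  | And form form
  | Or form form

definition Imp :: "form \<Rightarrow> form \<Rightarrow> form" where
  "Imp a b = Or (Neg a) b"

definition Iff :: "form \<Rightarrow> form \<Rightarrow> form" where
  "Iff a b = And (Imp a b) (Imp b a)"

primrec fv :: "form \<Rightarrow> nat set" where
  "fv Falsum = {}"
| "fv (Eq x y) = {x, y}"
| "fv (Rel P xs) = set xs"
| "fv (Neg a) = fv a"
| "fv (And a b) = fv a \<union> fv b"
| "fv (Or a b) = fv a \<union> fv b"

primrec rename :: "(nat \<Rightarrow> nat) \<Rightarrow> form \<Rightarrow> form" where
  "rename r Falsum = Falsum"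
| "rename r (Eq x y) = Eq (r x) (r y)"
| "rename r (Rel P xs) = Rel P (map r xs)"
| "rename r (Neg a) = Neg (rename r a)"
| "rename r (And a b) = And (rename r a) (rename r b)"
| "rename r (Or a b) = Or (rename r a) (rename r b)"

text \<open>
  A universal theory is given by the quantifier-free matrices of its axioms; each is read
  as its universal closure.
\<close>

record thy =
  preds :: "nat set"
  arity :: "nat \<Rightarrow> nat"
  axs :: "form set"

primrec in_lang :: "thy \<Rightarrow> form \<Rightarrow> bool" where
  "in_lang T Falsum = True"
| "in_lang T (Eq x y) = True"
| "in_lang T (Rel P xs) = (P \<in> preds T \<and> length xs = arity T P)"
| "in_lang T (Neg a) = in_lang T a"
| "in_lang T (And a b) = (in_lang T a \<and> in_lang T b)"
| "in_lang T (Or a b) = (in_lang T a \<and> in_lang T b)"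

text \<open>The formula says that \<open>x\<^sub>i = x\<^sub>j\<close> for some \<open>i < j < k\<close>.\<close>

definition coincidence :: "nat \<Rightarrow> form" where
  "coincidence k = foldr Or [Eq i j. j \<leftarrow> [0..<k], i \<leftarrow> [0..<j]] Falsum"

definition canonical_axiom :: "thy \<Rightarrow> nat \<Rightarrow> form" where
  "canonical_axiom T P = Imp (coincidence (arity T P)) (Neg (Rel P [0..<arity T P]))"

definition canonical_theory :: "thy \<Rightarrow> bool" where
  "canonical_theory T \<longleftrightarrow>
     finite (preds T) \<and> (\<forall>P\<in>preds T. arity T P \<ge> 1) \<and>
     (\<forall>a\<in>axs T. in_lang T a) \<and> (\<forall>P\<in>preds T. canonical_axiom T P \<in> axs T)"

record struct =
  verts :: "nat set"
  rel :: "nat \<Rightarrow> nat list set"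

text \<open>
  Relations are empty off the language, so that a structure is determined by its vertex
  set and its relations for the symbols of the language. The empty structure is allowed.
\<close>

definition structure_of :: "thy \<Rightarrow> struct \<Rightarrow> bool" where
  "structure_of T K \<longleftrightarrow>
     (\<forall>P\<in>preds T. rel K P \<subseteq> {xs. set xs \<subseteq> verts K \<and> length xs = arity T P}) \<and>
     (\<forall>P. P \<notin> preds T \<longrightarrow> rel K P = {})"

primrec sat :: "struct \<Rightarrow> (nat \<Rightarrow> nat) \<Rightarrow> form \<Rightarrow> bool" where
  "sat K v Falsum = False"
| "sat K v (Eq x y) = (v x = v y)"
| "sat K v (Rel P xs) = (map v xs \<in> rel K P)"
| "sat K v (Neg a) = (\<not> sat K v a)"
| "sat K v (And a b) = (sat K v a \<and> sat K v b)"
| "sat K v (Or a b) = (sat K v a \<or> sat K v b)"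

definition valid_in :: "struct \<Rightarrow> form \<Rightarrow> bool" where
  "valid_in K a \<longleftrightarrow> (\<forall>v. range v \<subseteq> verts K \<longrightarrow> sat K v a)"

definition model :: "thy \<Rightarrow> struct \<Rightarrow> bool" where
  "model T K \<longleftrightarrow> structure_of T K \<and> (\<forall>a\<in>axs T. valid_in K a)"

text \<open>
  Provability of the universal closure of \<open>a\<close>, expressed as truth in all models, finite or infinite.
  Restricting to models on sets of natural numbers loses nothing: the theory is universal,
  so a counterexample to \<open>a\<close> restricts to a finite one.
\<close>

definition entails :: "thy \<Rightarrow> form \<Rightarrow> bool" where
  "entails T a \<longleftrightarrow> (\<forall>K. model T K \<longrightarrow> valid_in K a)"

text \<open>
  An interpretation maps a predicate symbol \<open>P\<close> to a formula in the variables
  \<open>0, \<dots>, k(P) - 1\<close>; its values off the source language are irrelevant.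
\<close>

type_synonym interp = "nat \<Rightarrow> form"

definition interp_struct :: "thy \<Rightarrow> interp \<Rightarrow> struct \<Rightarrow> struct" where
  "interp_struct T1 I K =
     \<lparr>verts = verts K,
      rel = (\<lambda>P. if P \<in> preds T1
                  then {xs. set xs \<subseteq> verts K \<and> length xs = arity T1 P \<and> sat K (\<lambda>i. xs ! i) (I P)}
                  else {})\<rparr>"

definition open_interp :: "thy \<Rightarrow> thy \<Rightarrow> interp \<Rightarrow> bool" where
  "open_interp T1 T2 I \<longleftrightarrow>
     (\<forall>P\<in>preds T1. in_lang T2 (I P) \<and> fv (I P) \<subseteq> {..<arity T1 P}) \<and>
     (\<forall>K. model T2 K \<longrightarrow> model T1 (interp_struct T1 I K))"

definition interp_eq :: "thy \<Rightarrow> thy \<Rightarrow> interp \<Rightarrow> interp \<Rightarrow> bool" where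
  "interp_eq T1 T2 I I' \<longleftrightarrow> (\<forall>P\<in>preds T1. entails T2 (Iff (I P) (I' P)))"

primrec translate :: "interp \<Rightarrow> form \<Rightarrow> form" where
  "translate J Falsum = Falsum"
| "translate J (Eq x y) = Eq x y"
| "translate J (Rel P xs) = rename (\<lambda>i. xs ! i) (J P)"
| "translate J (Neg a) = Neg (translate J a)"
| "translate J (And a b) = And (translate J a) (translate J b)"
| "translate J (Or a b) = Or (translate J a) (translate J b)"

definition interp_comp :: "interp \<Rightarrow> interp \<Rightarrow> interp" where
  "interp_comp J I = (\<lambda>P. translate J (I P))"

definition int_pushout ::
  "thy \<Rightarrow> thy \<Rightarrow> thy \<Rightarrow> thy \<Rightarrow> interp \<Rightarrow> interp \<Rightarrow> interp \<Rightarrow> interp \<Rightarrow> bool" where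
  "int_pushout T T1 T2 T' I1 I2 J1 J2 \<longleftrightarrow>
     open_interp T1 T' J1 \<and> open_interp T2 T' J2 \<and>
     interp_eq T T' (interp_comp J1 I1) (interp_comp J2 I2) \<and>
     (\<forall>S L1 L2.
        canonical_theory S \<and> open_interp T1 S L1 \<and> open_interp T2 S L2 \<and>
        interp_eq T S (interp_comp L1 I1) (interp_comp L2 I2) \<longrightarrow>
        (\<exists>U. open_interp T' S U \<and>
             interp_eq T1 S (interp_comp U J1) L1 \<and> interp_eq T2 S (interp_comp U J2) L2 \<and>
             (\<forall>U'. open_interp T' S U' \<and>
                   interp_eq T1 S (interp_comp U' J1) L1 \<and>
                   interp_eq T2 S (interp_comp U' J2) L2 \<longrightarrow>
                   interp_eq T' S U' U)))"

definition struct_iso :: "struct \<Rightarrow> struct \<Rightarrow> bool" where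
  "struct_iso K L \<longleftrightarrow>
     (\<exists>f. bij_betw f (verts K) (verts L) \<and>
          (\<forall>P xs. set xs \<subseteq> verts K \<longrightarrow> (xs \<in> rel K P \<longleftrightarrow> map f xs \<in> rel L P)))"

definition induced :: "struct \<Rightarrow> nat set \<Rightarrow> struct" where
  "induced K S = \<lparr>verts = S, rel = (\<lambda>P. {xs \<in> rel K P. set xs \<subseteq> S})\<rparr>"

definition finite_model :: "thy \<Rightarrow> struct \<Rightarrow> bool" where
  "finite_model T K \<longleftrightarrow> model T K \<and> finite (verts K)"

definition iso_classes :: "thy \<Rightarrow> struct set set" where
  "iso_classes T =
     {K. finite_model T K} //
     {(K, L). finite_model T K \<and> finite_model T L \<and> struct_iso K L}"

definition class_size :: "struct set \<Rightarrow> nat" where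
  "class_size M = card (verts (SOME K. K \<in> M))"

definition density :: "struct set \<Rightarrow> struct \<Rightarrow> real" where
  "density M N =
     real (card {S. S \<subseteq> verts N \<and> card S = class_size M \<and> induced N S \<in> M})
       / real (card (verts N) choose class_size M)"

definition Hom_plus :: "thy \<Rightarrow> (struct set \<Rightarrow> real) set" where
  "Hom_plus T =
     {\<phi> \<in> iso_classes T \<rightarrow>\<^sub>E {0..1}.
        \<exists>N. (\<forall>n. finite_model T (N n)) \<and> strict_mono (\<lambda>n. card (verts (N n))) \<and>
            (\<forall>M\<in>iso_classes T. (\<lambda>n. density M (N n)) \<longlonglongrightarrow> \<phi> M)}"

text \<open>The functional \<open>\<phi>\<^sup>I\<close>, for \<open>I\<close> an interpretation of \<open>T1\<close> in \<open>T2\<close> and \<open>\<phi>\<close> a functional for \<open>T2\<close>.\<close>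

definition pullback ::
  "thy \<Rightarrow> thy \<Rightarrow> interp \<Rightarrow> (struct set \<Rightarrow> real) \<Rightarrow> (struct set \<Rightarrow> real)" where
  "pullback T1 T2 I \<phi> =
     (\<lambda>M\<in>iso_classes T1.
        \<Sum>N | N \<in> iso_classes T2 \<and> class_size N = class_size M \<and>
              (\<exists>K\<in>N. interp_struct T1 I K \<in> M). \<phi> N)"

end

theory Submission
  imports Defs "HOL-Library.Diagonal_Subsequence" "HOL-Library.Countable_Set"
begin

text \<open>
  Restricted to the classes of models of size \<open>n\<close>, a functional in \<open>Hom_plus\<close> is a probability
  distribution, and a model drawn from it has, by Chebyshev's inequality, densities close to the
  values of the functional with probability tending to 1. The distributions of \<open>\<phi>1\<close> and \<open>\<phi>2\<close> have the
  same image on models of \<open>T\<close>. Once both assign more than 1/2 to their typical models, some model of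
  \<open>T\<close> of size \<open>n\<close> therefore carries a typical model of \<open>T1\<close> and a typical model of \<open>T2\<close>; together
  they form a model of the concrete pushout, hence give one of \<open>T'\<close> by the universal property. Along
  a sequence of such models the densities of the two reducts tend to \<open>\<phi>1\<close> and \<open>\<phi>2\<close>, and a
  subsequence on which all densities converge yields \<open>\<psi>\<close>. No coupling of the two distributions is
  needed.
\<close>

section \<open>Satisfaction, isomorphism and interpretation\<close>

text \<open>The bound 1/2 is a pigeonhole on isomorphism classes of \<open>T\<close>: the classes
  reached by typical models of \<open>T1\<close> have mass above 1/2 in the common image
  distribution, so the models of \<open>T2\<close> over them have more \<open>\<phi>2\<close>-mass
  than the atypical ones can carry. One common model per size is enough because the conclusion
  constrains \<open>\<psi>\<close> only through its reducts, and densities of a reduct are finite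
  sums of densities of the model, hence pass to limits. The size from which typical models prevail
  depends on the finite set of classes tested and on the tolerance, so the set grows and the
  tolerance shrinks along the sequence. The pigeonhole yields isomorphic reducts to
  \<open>T\<close>, whereas gluing needs equal ones. Isomorphisms therefore carry explicit maps,
  along which a model is moved until its reduct is a prescribed structure. Every probabilistic
  estimate is a count of subsets of a finite model, followed by a limit.\<close>

lemma sat_cong_fv: "(\<And>i. i \<in> fv a \<Longrightarrow> v i = w i) \<Longrightarrow> sat K v a = sat K w a"
proof (induction a)
  case (Rel P xs)
  then have "map v xs = map w xs" by simp
  then show ?case by (simp only: sat.simps)
qed auto

lemma sat_rename: "sat K v (rename r a) = sat K (v \<circ> r) a"
  by (induction a) (auto simp: comp_def)

lemma sat_Iff [simp]: "sat K v (Iff a b) \<longleftrightarrow> (sat K v a \<longleftrightarrow> sat K v b)"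
  by (auto simp: Iff_def Imp_def)

lemma in_lang_Iff [simp]: "in_lang T (Iff a b) \<longleftrightarrow> in_lang T a \<and> in_lang T b"
  by (auto simp: Iff_def Imp_def)

lemma in_lang_rename [simp]: "in_lang T (rename r a) = in_lang T a"
  by (induction a) auto

lemma in_lang_translate:
  "in_lang T a \<Longrightarrow> (\<And>P. P \<in> preds T \<Longrightarrow> in_lang S (J P)) \<Longrightarrow> in_lang S (translate J a)"
  by (induction a) auto

text \<open>Split off from \<open>open_interp\<close> so that it also covers interpretations not yet
  known to be open, such as composites.\<close>

definition fv_bounded :: "thy \<Rightarrow> interp \<Rightarrow> bool" where
  "fv_bounded T I \<longleftrightarrow> (\<forall>P\<in>preds T. fv (I P) \<subseteq> {..<arity T P})"

lemma open_interp_fv_bounded: "open_interp T S I \<Longrightarrow> fv_bounded T I"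
  by (auto simp: open_interp_def fv_bounded_def)

lemma sat_interp:
  assumes "fv_bounded T I" "P \<in> preds T" "set xs \<subseteq> verts K" "length xs = arity T P"
    and "\<And>i. i < length xs \<Longrightarrow> v i = xs ! i"
  shows "sat K v (I P) \<longleftrightarrow> xs \<in> rel (interp_struct T I K) P"
proof -
  have "sat K v (I P) = sat K (\<lambda>i. xs ! i) (I P)"
    using assms by (intro sat_cong_fv) (auto simp: fv_bounded_def)
  then show ?thesis using assms by (simp add: interp_struct_def)
qed

lemma verts_interp_struct [simp]: "verts (interp_struct T I K) = verts K"
  by (simp add: interp_struct_def)

lemma structure_of_interp_struct: "structure_of T (interp_struct T I K)"
  by (auto simp: structure_of_def interp_struct_def)

text \<open>The condition on \<open>v\<close> is forced: \<open>interp_struct\<close> keeps only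
  tuples of vertices, while \<open>sat\<close> evaluates \<open>I P\<close> at any tuple.\<close>

lemma sat_translate:
  assumes "fv_bounded T J" "in_lang T a" "v ` fv a \<subseteq> verts K"
  shows "sat K v (translate J a) \<longleftrightarrow> sat (interp_struct T J K) v a"
  using assms(2,3)
proof (induction a)
  case (Rel P xs)
  then show ?case
    using sat_interp[OF assms(1), of P "map v xs" K "v \<circ> (\<lambda>i. xs ! i)"] by (auto simp: sat_rename)
qed auto

lemma valid_in_translate:
  assumes "fv_bounded T J" "in_lang T a"
  shows "valid_in K (translate J a) \<longleftrightarrow> valid_in (interp_struct T J K) a"
  unfolding valid_in_def using sat_translate[OF assms] by (simp add: image_subset_iff)

lemma interp_struct_comp:
  assumes "fv_bounded T I" "\<And>P. P \<in> preds T \<Longrightarrow> in_lang T1 (I P)" "fv_bounded T1 J"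
  shows "interp_struct T (interp_comp J I) K = interp_struct T I (interp_struct T1 J K)"
proof -
  have "sat K (\<lambda>i. xs ! i) (translate J (I P)) \<longleftrightarrow> sat (interp_struct T1 J K) (\<lambda>i. xs ! i) (I P)"
    if "P \<in> preds T" "set xs \<subseteq> verts K" "length xs = arity T P" for P xs
    using that assms(1) by (intro sat_translate assms) (force simp: fv_bounded_def)+
  then show ?thesis
    by (auto simp: interp_struct_def interp_comp_def fun_eq_iff)
qed

lemma fv_rename: "fv (rename r a) = r ` fv a"
  by (induction a) auto

lemma fv_translate:
  assumes "fv_bounded T J" "in_lang T a"
  shows "fv (translate J a) \<subseteq> fv a"
  using assms(2)
proof (induction a)
  case (Rel P xs)
  then have "fv (J P) \<subseteq> {..<length xs}" using assms(1) by (auto simp: fv_bounded_def)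
  then show ?case by (force simp: fv_rename)
qed auto

lemma fv_bounded_comp:
  assumes "fv_bounded T I" "\<And>P. P \<in> preds T \<Longrightarrow> in_lang T1 (I P)" "fv_bounded T1 J"
  shows "fv_bounded T (interp_comp J I)"
  using assms fv_translate[OF assms(3)] unfolding fv_bounded_def interp_comp_def by blast

lemma interp_struct_eqI:
  assumes "interp_eq T S I I'" "fv_bounded T I" "fv_bounded T I'"
    and "\<And>P. P \<in> preds T \<Longrightarrow> arity T P \<ge> 1" "model S K"
  shows "interp_struct T I K = interp_struct T I' K"
proof -
  have "xs \<in> rel (interp_struct T I K) P \<longleftrightarrow> xs \<in> rel (interp_struct T I' K) P"
    if P: "P \<in> preds T" and xs: "set xs \<subseteq> verts K" "length xs = arity T P" for P xs
  proof -
    \<comment> \<open>\<open>interp_eq\<close> speaks of valuations with all values in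
      \<open>verts K\<close>, but \<open>xs ! i\<close> is uncontrolled past the end of the list.
      Repeating the first entry repairs this; it exists because arities are at least 1.\<close>
    define v where "v = (\<lambda>i. if i < length xs then xs ! i else xs ! 0)"
    have "0 < length xs" using assms(4)[OF P] xs by auto
    then have "\<And>i. v i \<in> set xs"
      by (simp add: v_def)
    then have "range v \<subseteq> verts K" using xs by blast
    then have "sat K v (I P) \<longleftrightarrow> sat K v (I' P)"
      using assms(1,5) P by (auto simp: interp_eq_def entails_def valid_in_def)
    moreover have "sat K v (I P) \<longleftrightarrow> xs \<in> rel (interp_struct T I K) P"
      "sat K v (I' P) \<longleftrightarrow> xs \<in> rel (interp_struct T I' K) P"
      using assms(2,3) P xs by (intro sat_interp; simp add: v_def)+
    ultimately show ?thesis by simp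
  qed
  then have "rel (interp_struct T I K) = rel (interp_struct T I' K)"
    by (fastforce simp: fun_eq_iff interp_struct_def)
  then show ?thesis by (simp add: interp_struct_def)
qed

section \<open>Induced substructures\<close>

lemma sat_induced: "v ` fv a \<subseteq> S \<Longrightarrow> sat (induced K S) v a = sat K v a"
  by (induction a) (auto simp: induced_def)

lemma verts_induced [simp]: "verts (induced K S) = S"
  by (simp add: induced_def)

lemma induced_induced: "A \<subseteq> S \<Longrightarrow> induced (induced K S) A = induced K A"
  by (auto simp: induced_def fun_eq_iff)

lemma model_induced:
  assumes "model T K" "S \<subseteq> verts K"
  shows "model T (induced K S)"
proof -
  have "structure_of T (induced K S)"
    using assms by (fastforce simp: model_def structure_of_def induced_def)
  moreover have "valid_in (induced K S) a" if "a \<in> axs T" for a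
    unfolding valid_in_def
  proof (intro allI impI)
    fix v :: "nat \<Rightarrow> nat"
    assume "range v \<subseteq> verts (induced K S)"
    then have "range v \<subseteq> S" by simp
    then have "sat (induced K S) v a = sat K v a" "range v \<subseteq> verts K"
      using assms by (auto intro!: sat_induced)
    then show "sat (induced K S) v a"
      using assms that by (auto simp: model_def valid_in_def)
  qed
  ultimately show ?thesis by (simp add: model_def)
qed

text \<open>Interpreting formulas are quantifier-free, so their truth at a tuple is decided inside
  any vertex set containing it. Hence sampling commutes with taking reducts.\<close>

lemma induced_interp_struct:
  assumes "fv_bounded T I" "S \<subseteq> verts K"
  shows "induced (interp_struct T I K) S = interp_struct T I (induced K S)"
proof -
  have "sat (induced K S) (\<lambda>i. xs ! i) (I P) = sat K (\<lambda>i. xs ! i) (I P)"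
    if "P \<in> preds T" "set xs \<subseteq> S" "length xs = arity T P" for P xs
    using that assms(1) by (intro sat_induced) (force simp: fv_bounded_def)
  then show ?thesis
    using assms(2) by (auto simp: interp_struct_def induced_def fun_eq_iff)
qed

section \<open>Isomorphisms with a named map\<close>

definition iso_by :: "(nat \<Rightarrow> nat) \<Rightarrow> struct \<Rightarrow> struct \<Rightarrow> bool" where
  "iso_by f K L \<longleftrightarrow> bij_betw f (verts K) (verts L) \<and>
     (\<forall>P xs. set xs \<subseteq> verts K \<longrightarrow> (xs \<in> rel K P \<longleftrightarrow> map f xs \<in> rel L P))"

lemma struct_iso_iff: "struct_iso K L \<longleftrightarrow> (\<exists>f. iso_by f K L)"
  by (simp add: struct_iso_def iso_by_def)

lemma iso_by_verts: "iso_by f K L \<Longrightarrow> verts L = f ` verts K"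
  by (simp add: iso_by_def bij_betw_def)

lemma iso_by_id: "iso_by id K K"
  by (simp add: iso_by_def)

lemma iso_by_comp:
  assumes "iso_by f K L" "iso_by g L M"
  shows "iso_by (g \<circ> f) K M"
proof -
  have "map f xs \<in> rel L P \<longleftrightarrow> map g (map f xs) \<in> rel M P" if "set xs \<subseteq> verts K" for P xs
  proof -
    have "set (map f xs) \<subseteq> verts L" using that iso_by_verts[OF assms(1)] by auto
    then show ?thesis using assms that unfolding iso_by_def by blast
  qed
  then show ?thesis
    using assms by (auto simp: iso_by_def intro: bij_betw_trans)
qed

lemma iso_by_inv:
  assumes "iso_by f K L"
  shows "iso_by (inv_into (verts K) f) L K"
proof -
  let ?g = "inv_into (verts K) f"
  have bij: "bij_betw f (verts K) (verts L)" using assms by (simp add: iso_by_def)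
  have bij': "bij_betw ?g (verts L) (verts K)" by (rule bij_betw_inv_into[OF bij])
  have "ys \<in> rel L P \<longleftrightarrow> map ?g ys \<in> rel K P" if "set ys \<subseteq> verts L" for P ys
  proof -
    have "set (map ?g ys) \<subseteq> verts K" using that bij' by (auto simp: bij_betw_def)
    moreover have "map f (map ?g ys) = ys"
      using that bij_betw_inv_into_right[OF bij] by (auto intro!: map_idI)
    ultimately show ?thesis using assms by (metis iso_by_def)
  qed
  then show ?thesis using bij' by (simp add: iso_by_def)
qed

lemma struct_iso_refl: "struct_iso K K"
  using iso_by_id struct_iso_iff by blast

lemma struct_iso_sym: "struct_iso K L \<Longrightarrow> struct_iso L K"
  using iso_by_inv struct_iso_iff by blast

lemma struct_iso_trans: "struct_iso K L \<Longrightarrow> struct_iso L M \<Longrightarrow> struct_iso K M"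
  unfolding struct_iso_iff using iso_by_comp by blast

lemma struct_iso_card: "struct_iso K L \<Longrightarrow> card (verts K) = card (verts L)"
  by (auto simp: struct_iso_iff iso_by_def dest: bij_betw_same_card)

lemma sat_iso_by:
  assumes "iso_by f K L" "v ` fv a \<subseteq> verts K"
  shows "sat K v a \<longleftrightarrow> sat L (f \<circ> v) a"
  using assms(2)
proof (induction a)
  case (Eq x y)
  then show ?case using assms(1) by (auto simp: iso_by_def bij_betw_def inj_on_def)
next
  case (Rel P xs)
  then have "set (map v xs) \<subseteq> verts K" by auto
  then have "map v xs \<in> rel K P \<longleftrightarrow> map f (map v xs) \<in> rel L P"
    using assms(1) unfolding iso_by_def by blast
  then show ?case by (simp add: comp_def)
qed auto

text \<open>The same map serves for the reducts, which is why the map is named: existence of some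
  isomorphism of reducts would not suffice for transport along a given one.\<close>

lemma iso_by_interp_struct:
  assumes "iso_by f K L" "fv_bounded T I"
  shows "iso_by f (interp_struct T I K) (interp_struct T I L)"
proof -
  have L: "verts L = f ` verts K" using assms(1) by (rule iso_by_verts)
  have "xs \<in> rel (interp_struct T I K) P \<longleftrightarrow> map f xs \<in> rel (interp_struct T I L) P"
    if xs: "set xs \<subseteq> verts K" for P xs
  proof (cases "P \<in> preds T \<and> length xs = arity T P")
    case True
    have "xs \<in> rel (interp_struct T I K) P \<longleftrightarrow> sat K (\<lambda>i. xs ! i) (I P)"
      using True assms(2) xs by (intro sat_interp[symmetric]) auto
    also have "\<dots> \<longleftrightarrow> sat L (f \<circ> (\<lambda>i. xs ! i)) (I P)"
      using True assms xs by (intro sat_iso_by[OF assms(1)]) (force simp: fv_bounded_def)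
    also have "\<dots> \<longleftrightarrow> map f xs \<in> rel (interp_struct T I L) P"
      using True assms(2) xs L by (intro sat_interp) auto
    finally show ?thesis .
  qed (auto simp: interp_struct_def)
  then show ?thesis using assms(1) by (simp add: iso_by_def)
qed

text \<open>\<open>structure_of T L\<close> is a separate hypothesis because \<open>iso_by\<close>
  does not constrain tuples of \<open>L\<close> that leave its vertex set.\<close>

lemma model_iso_by:
  assumes "iso_by f K L" "model T K" "structure_of T L"
  shows "model T L"
proof -
  have bij: "bij_betw f (verts K) (verts L)" using assms by (simp add: iso_by_def)
  have "sat L v a" if "a \<in> axs T" "range v \<subseteq> verts L" for a v
  proof -
    let ?w = "inv_into (verts K) f \<circ> v"
    have "range ?w \<subseteq> verts K"
      using that bij_betw_inv_into[OF bij] by (auto simp: bij_betw_def)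
    moreover from this have "sat K ?w a \<longleftrightarrow> sat L (f \<circ> ?w) a"
      by (intro sat_iso_by[OF assms(1)]) auto
    moreover have "f \<circ> ?w = v"
      using that bij_betw_inv_into_right[OF bij] by (auto simp: fun_eq_iff)
    ultimately show ?thesis using assms(2) that by (auto simp: model_def valid_in_def)
  qed
  then show ?thesis using assms(3) by (auto simp: model_def valid_in_def)
qed

lemma model_transport:
  assumes "model T K" "inj_on f (verts K)"
  obtains L where "model T L" "iso_by f K L" "verts L = f ` verts K"
proof -
  let ?L = "\<lparr>verts = f ` verts K, rel = \<lambda>P. map f ` rel K P\<rparr>"
  have sub: "set xs \<subseteq> verts K" if "xs \<in> rel K P" for xs P
    using assms(1) that by (cases "P \<in> preds T") (auto simp: model_def structure_of_def)
  have "xs \<in> rel K P \<longleftrightarrow> map f xs \<in> map f ` rel K P" if xs: "set xs \<subseteq> verts K" for xs P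
  proof
    assume "map f xs \<in> map f ` rel K P"
    then obtain ys where ys: "ys \<in> rel K P" "map f xs = map f ys" by auto
    then have "xs = ys"
      using sub[OF ys(1)] xs assms(2) by (metis inj_on_subset le_sup_iff map_inj_on)
    then show "xs \<in> rel K P" using ys by simp
  qed auto
  then have iso: "iso_by f K ?L"
    using assms(2) by (auto simp: iso_by_def bij_betw_def)
  moreover have "structure_of T ?L"
    using assms(1) by (fastforce simp: model_def structure_of_def)
  ultimately show ?thesis using that model_iso_by[OF iso assms(1)] by simp
qed

text \<open>A structure is the image of its source under the map. This turns isomorphic reducts into
  equal ones.\<close>

lemma iso_by_unique:
  assumes "iso_by f K L" "iso_by f K L'" "structure_of T L" "structure_of T L'"
  shows "L = L'"
proof -
  have le: "rel A P \<subseteq> rel B P"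
    if "iso_by f K A" "iso_by f K B" "structure_of T A" for A B P
  proof
    fix ys assume ys: "ys \<in> rel A P"
    then have "P \<in> preds T" using that(3) by (auto simp: structure_of_def)
    then have "set ys \<subseteq> f ` verts K"
      using ys that(3) iso_by_verts[OF that(1)] unfolding structure_of_def by blast
    then have "ys \<in> map f ` lists (verts K)"
      unfolding lists_image[symmetric] by blast
    then obtain xs where "set xs \<subseteq> verts K" "ys = map f xs" by auto
    then show "ys \<in> rel B P" using that ys by (auto simp: iso_by_def)
  qed
  have "rel L = rel L'" using le assms by (auto simp: fun_eq_iff)
  moreover have "verts L = verts L'" using assms iso_by_verts by metis
  ultimately show ?thesis by simp
qed

lemma iso_by_induced:
  assumes "iso_by f K L" "S \<subseteq> verts K"
  shows "iso_by f (induced K S) (induced L (f ` S))"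
  using assms unfolding iso_by_def induced_def
  by (auto intro: bij_betw_subset)

section \<open>Gluing models along a common interpretation\<close>

text \<open>The languages of \<open>T1\<close> and \<open>T2\<close> are made disjoint by using the even and the odd symbols.\<close>

definition even_interp :: "thy \<Rightarrow> interp" where
  "even_interp T1 = (\<lambda>P. Rel (2 * P) [0..<arity T1 P])"

definition odd_interp :: "thy \<Rightarrow> interp" where
  "odd_interp T2 = (\<lambda>P. Rel (2 * P + 1) [0..<arity T2 P])"

text \<open>The standard concrete pushout of \<open>I1\<close> and \<open>I2\<close>. The given
  \<open>T'\<close> is compared with it only through the universal property.\<close>

definition glued_theory :: "thy \<Rightarrow> thy \<Rightarrow> thy \<Rightarrow> interp \<Rightarrow> interp \<Rightarrow> thy" where
  "glued_theory T T1 T2 I1 I2 =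
     \<lparr>preds = (\<lambda>P. 2 * P) ` preds T1 \<union> (\<lambda>P. 2 * P + 1) ` preds T2,
      arity = (\<lambda>Q. if even Q then arity T1 (Q div 2) else arity T2 (Q div 2)),
      axs = translate (even_interp T1) ` axs T1 \<union> translate (odd_interp T2) ` axs T2 \<union>
        (\<lambda>P. Iff (translate (even_interp T1) (I1 P)) (translate (odd_interp T2) (I2 P))) ` preds T\<rparr>"

definition glue :: "struct \<Rightarrow> struct \<Rightarrow> struct" where
  "glue K1 K2 = \<lparr>verts = verts K1,
     rel = (\<lambda>Q. if even Q then rel K1 (Q div 2) else rel K2 (Q div 2))\<rparr>"

lemma translate_coincidence: "translate J (coincidence k) = coincidence k"
proof -
  have "translate J (foldr Or as Falsum) = foldr Or as Falsum" if "\<forall>a\<in>set as. \<exists>i j. a = Eq i j" for as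
    using that by (induction as) auto
  then show ?thesis unfolding coincidence_def by (rule) auto
qed

lemma nth_upt_map: "length xs = k \<Longrightarrow> map ((!) xs) [0..<k] = xs"
  using map_nth by blast

lemma fv_bounded_even: "fv_bounded T1 (even_interp T1)"
  by (auto simp: fv_bounded_def even_interp_def)

lemma fv_bounded_odd: "fv_bounded T2 (odd_interp T2)"
  by (auto simp: fv_bounded_def odd_interp_def)

lemma in_lang_even: "P \<in> preds T1 \<Longrightarrow> in_lang (glued_theory T T1 T2 I1 I2) (even_interp T1 P)"
  by (auto simp: glued_theory_def even_interp_def)

lemma in_lang_odd: "P \<in> preds T2 \<Longrightarrow> in_lang (glued_theory T T1 T2 I1 I2) (odd_interp T2 P)"
  by (auto simp: glued_theory_def odd_interp_def)

text \<open>Needed because the universal property of \<open>T'\<close> ranges over canonical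
  theories.\<close>

lemma canonical_glued_theory:
  assumes "canonical_theory T1" "canonical_theory T2" "open_interp T T1 I1" "open_interp T T2 I2"
  shows "canonical_theory (glued_theory T T1 T2 I1 I2)" (is "canonical_theory ?S")
proof -
  have lang: "in_lang ?S a" if a: "a \<in> axs ?S" for a
  proof -
    consider b where "b \<in> axs T1" "a = translate (even_interp T1) b"
      | b where "b \<in> axs T2" "a = translate (odd_interp T2) b"
      | P where "P \<in> preds T"
        "a = Iff (translate (even_interp T1) (I1 P)) (translate (odd_interp T2) (I2 P))"
      using a by (auto simp: glued_theory_def)
    then show ?thesis
    proof cases
      case 1
      then show ?thesis using assms(1) in_lang_even
        by (auto simp: canonical_theory_def intro!: in_lang_translate)
    next
      case 2
      then show ?thesis using assms(2) in_lang_odd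
        by (auto simp: canonical_theory_def intro!: in_lang_translate)
    next
      case 3
      then have "in_lang T1 (I1 P)" "in_lang T2 (I2 P)"
        using assms(3,4) by (auto simp: open_interp_def)
      then show ?thesis
        using in_lang_translate in_lang_even in_lang_odd 3 by (metis in_lang_Iff)
    qed
  qed
  \<comment> \<open>Membership in \<open>axs\<close> is syntactic, so the translated axiom has to be
    literally the canonical axiom of the renamed symbol, not just equivalent to it.\<close>
  have ax1: "canonical_axiom ?S (2 * P) = translate (even_interp T1) (canonical_axiom T1 P)" for P
    by (simp add: canonical_axiom_def Imp_def translate_coincidence even_interp_def
        glued_theory_def nth_upt_map)
  have ax2: "canonical_axiom ?S (2 * P + 1) = translate (odd_interp T2) (canonical_axiom T2 P)" for P
    by (simp add: canonical_axiom_def Imp_def translate_coincidence odd_interp_def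
        glued_theory_def nth_upt_map)
  have "canonical_axiom ?S Q \<in> axs ?S" if Q: "Q \<in> preds ?S" for Q
  proof -
    consider P where "P \<in> preds T1" "Q = 2 * P" | P where "P \<in> preds T2" "Q = 2 * P + 1"
      using Q by (auto simp: glued_theory_def)
    then show ?thesis
      using assms(1,2) ax1 ax2
      by cases (auto simp: canonical_theory_def glued_theory_def simp del: One_nat_def)
  qed
  then show ?thesis
    using assms(1,2) lang by (auto simp: canonical_theory_def glued_theory_def)
qed

lemma open_interp_even:
  assumes "canonical_theory T1"
  shows "open_interp T1 (glued_theory T T1 T2 I1 I2) (even_interp T1)"
proof -
  have "model T1 (interp_struct T1 (even_interp T1) K)"
    if "model (glued_theory T T1 T2 I1 I2) K" for K
    unfolding model_def
  proof (intro conjI ballI structure_of_interp_struct)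
    fix a assume a: "a \<in> axs T1"
    then have "valid_in K (translate (even_interp T1) a)"
      using that by (auto simp: model_def glued_theory_def)
    then show "valid_in (interp_struct T1 (even_interp T1) K) a"
      using a assms valid_in_translate[OF fv_bounded_even] by (auto simp: canonical_theory_def)
  qed
  then show ?thesis
    using fv_bounded_even in_lang_even by (auto simp: open_interp_def fv_bounded_def)
qed

lemma open_interp_odd:
  assumes "canonical_theory T2"
  shows "open_interp T2 (glued_theory T T1 T2 I1 I2) (odd_interp T2)"
proof -
  have "model T2 (interp_struct T2 (odd_interp T2) K)"
    if "model (glued_theory T T1 T2 I1 I2) K" for K
    unfolding model_def
  proof (intro conjI ballI structure_of_interp_struct)
    fix a assume a: "a \<in> axs T2"
    then have "valid_in K (translate (odd_interp T2) a)"
      using that by (auto simp: model_def glued_theory_def)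
    then show "valid_in (interp_struct T2 (odd_interp T2) K) a"
      using a assms valid_in_translate[OF fv_bounded_odd] by (auto simp: canonical_theory_def)
  qed
  then show ?thesis
    using fv_bounded_odd in_lang_odd by (auto simp: open_interp_def fv_bounded_def)
qed

lemma interp_eq_even_odd:
  "interp_eq T (glued_theory T T1 T2 I1 I2)
     (interp_comp (even_interp T1) I1) (interp_comp (odd_interp T2) I2)"
  unfolding interp_eq_def entails_def interp_comp_def model_def
  by (auto simp: glued_theory_def)

lemma even_interp_glue:
  assumes "structure_of T1 K1"
  shows "interp_struct T1 (even_interp T1) (glue K1 K2) = K1"
proof -
  have "rel (interp_struct T1 (even_interp T1) (glue K1 K2)) P = rel K1 P" for P
  proof (cases "P \<in> preds T1")
    case True
    then have "set xs \<subseteq> verts K1 \<and> length xs = arity T1 P" if "xs \<in> rel K1 P" for xs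
      using that assms by (auto simp: structure_of_def)
    then show ?thesis
      using True assms by (auto simp: interp_struct_def even_interp_def glue_def nth_upt_map)
  qed (use assms in \<open>auto simp: structure_of_def interp_struct_def\<close>)
  then show ?thesis
    by (intro struct.equality) (auto simp: glue_def)
qed

lemma odd_interp_glue:
  assumes "structure_of T2 K2" "verts K1 = verts K2"
  shows "interp_struct T2 (odd_interp T2) (glue K1 K2) = K2"
proof -
  have "rel (interp_struct T2 (odd_interp T2) (glue K1 K2)) P = rel K2 P" for P
  proof (cases "P \<in> preds T2")
    case True
    then have "set xs \<subseteq> verts K2 \<and> length xs = arity T2 P" if "xs \<in> rel K2 P" for xs
      using that assms by (auto simp: structure_of_def)
    then show ?thesis
      using True assms by (auto simp: interp_struct_def odd_interp_def glue_def nth_upt_map)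
  qed (use assms in \<open>auto simp: structure_of_def interp_struct_def\<close>)
  then show ?thesis
    using assms(2) by (intro struct.equality) (auto simp: glue_def)
qed

text \<open>The linking axiom for \<open>P\<close> holds because both of its sides decide whether a
  tuple lies in \<open>P\<close> in the common reduct to \<open>T\<close>.\<close>

lemma model_glue:
  assumes "canonical_theory T1" "canonical_theory T2" "open_interp T T1 I1" "open_interp T T2 I2"
    and "model T1 K1" "model T2 K2" "interp_struct T I1 K1 = interp_struct T I2 K2"
  shows "model (glued_theory T T1 T2 I1 I2) (glue K1 K2)" (is "model ?S ?G")
proof -
  have v: "verts K1 = verts K2" using assms(7) by (metis verts_interp_struct)
  have s: "structure_of T1 K1" "structure_of T2 K2" using assms by (auto simp: model_def)
  have "structure_of ?S ?G"
    unfolding structure_of_def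
  proof (intro conjI ballI allI impI)
    fix Q
    show "rel ?G Q \<subseteq> {xs. set xs \<subseteq> verts ?G \<and> length xs = arity ?S Q}" if "Q \<in> preds ?S"
      using that s v by (fastforce simp: structure_of_def glued_theory_def glue_def)
    show "rel ?G Q = {}" if "Q \<notin> preds ?S"
      using that s by (cases "even Q")
        (auto simp: structure_of_def glued_theory_def glue_def image_iff elim!: evenE oddE)
  qed
  moreover have "valid_in ?G a" if a: "a \<in> axs ?S" for a
  proof -
    consider b where "b \<in> axs T1" "a = translate (even_interp T1) b"
      | b where "b \<in> axs T2" "a = translate (odd_interp T2) b"
      | P where "P \<in> preds T"
        "a = Iff (translate (even_interp T1) (I1 P)) (translate (odd_interp T2) (I2 P))"
      using a by (auto simp: glued_theory_def)
    then show ?thesis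
    proof cases
      case 1
      then show ?thesis using assms(1,5) valid_in_translate[OF fv_bounded_even]
          even_interp_glue[OF s(1)] by (auto simp: canonical_theory_def model_def)
    next
      case 2
      then show ?thesis using assms(2,6) valid_in_translate[OF fv_bounded_odd]
          odd_interp_glue[OF s(2) v] by (auto simp: canonical_theory_def model_def)
    next
      case 3
      show ?thesis
        unfolding valid_in_def
      proof (intro allI impI)
        fix v' :: "nat \<Rightarrow> nat"
        assume "range v' \<subseteq> verts ?G"
        then have r: "range v' \<subseteq> verts K1" by (simp add: glue_def)
        have l: "in_lang T1 (I1 P)" "in_lang T2 (I2 P)"
          using assms(3,4) 3 by (auto simp: open_interp_def)
        have "sat ?G v' (translate (even_interp T1) (I1 P)) \<longleftrightarrow> sat K1 v' (I1 P)"
          using sat_translate[OF fv_bounded_even l(1), of v' ?G] r even_interp_glue[OF s(1)]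
          by (auto simp: glue_def)
        also have "\<dots> \<longleftrightarrow> map v' [0..<arity T P] \<in> rel (interp_struct T I1 K1) P"
          using r 3 by (intro sat_interp open_interp_fv_bounded[OF assms(3)]) auto
        also have "\<dots> \<longleftrightarrow> sat K2 v' (I2 P)"
          unfolding assms(7)
          using r v 3 by (intro sat_interp[symmetric] open_interp_fv_bounded[OF assms(4)]) auto
        also have "\<dots> \<longleftrightarrow> sat ?G v' (translate (odd_interp T2) (I2 P))"
          using sat_translate[OF fv_bounded_odd l(2), of v' ?G] r v odd_interp_glue[OF s(2) v]
          by (auto simp: glue_def)
        finally show "sat ?G v' a" using 3 by simp
      qed
    qed
  qed
  ultimately show ?thesis by (simp add: model_def)
qed

text \<open>The mediating interpretation \<open>U\<close> acts contravariantly on models and turns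
  the glued model into a model of \<open>T'\<close>. Since \<open>U\<close> composed with
  \<open>J1\<close> is provably \<open>even_interp T1\<close>, the reduct along \<open>J1\<close> is
  the even part of the glued model, which is \<open>K1\<close>; likewise for
  \<open>K2\<close>.\<close>

lemma pushout_amalgam:
  assumes "canonical_theory T" "canonical_theory T1" "canonical_theory T2"
    and "open_interp T T1 I1" "open_interp T T2 I2"
    and "int_pushout T T1 T2 T' I1 I2 J1 J2"
    and "model T1 K1" "model T2 K2" "interp_struct T I1 K1 = interp_struct T I2 K2"
  obtains N where "model T' N" "interp_struct T1 J1 N = K1" "interp_struct T2 J2 N = K2"
proof -
  let ?S = "glued_theory T T1 T2 I1 I2" and ?G = "glue K1 K2"
  have J: "open_interp T1 T' J1" "open_interp T2 T' J2"
    using assms(6) by (auto simp: int_pushout_def)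
  obtain U where U: "open_interp T' ?S U"
    and U1: "interp_eq T1 ?S (interp_comp U J1) (even_interp T1)"
    and U2: "interp_eq T2 ?S (interp_comp U J2) (odd_interp T2)"
    using assms(6) canonical_glued_theory[OF assms(2-5)] open_interp_even[OF assms(2)]
      open_interp_odd[OF assms(3)] interp_eq_even_odd
    unfolding int_pushout_def by blast
  have G: "model ?S ?G" by (rule model_glue[OF assms(2-5,7-9)])
  have v: "verts K1 = verts K2" using assms(9) by (metis verts_interp_struct)
  have s: "structure_of T1 K1" "structure_of T2 K2" using assms by (auto simp: model_def)
  let ?N = "interp_struct T' U ?G"
  have b: "fv_bounded T1 J1" "fv_bounded T2 J2" "fv_bounded T' U"
    using J U open_interp_fv_bounded by blast+
  have l: "\<And>P. P \<in> preds T1 \<Longrightarrow> in_lang T' (J1 P)" "\<And>P. P \<in> preds T2 \<Longrightarrow> in_lang T' (J2 P)"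
    using J by (auto simp: open_interp_def)
  have "interp_struct T1 J1 ?N = interp_struct T1 (interp_comp U J1) ?G"
    using interp_struct_comp[OF b(1) l(1) b(3)] by simp
  also have "\<dots> = interp_struct T1 (even_interp T1) ?G"
    using assms(2) by (intro interp_struct_eqI[OF U1 fv_bounded_comp[OF b(1) l(1) b(3)]
          fv_bounded_even _ G]) (auto simp: canonical_theory_def)
  also have "\<dots> = K1" by (rule even_interp_glue[OF s(1)])
  finally have 1: "interp_struct T1 J1 ?N = K1" .
  have "interp_struct T2 J2 ?N = interp_struct T2 (interp_comp U J2) ?G"
    using interp_struct_comp[OF b(2) l(2) b(3)] by simp
  also have "\<dots> = interp_struct T2 (odd_interp T2) ?G"
    using assms(3) by (intro interp_struct_eqI[OF U2 fv_bounded_comp[OF b(2) l(2) b(3)]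
          fv_bounded_odd _ G]) (auto simp: canonical_theory_def)
  also have "\<dots> = K2" by (rule odd_interp_glue[OF s(2) v])
  finally have 2: "interp_struct T2 J2 ?N = K2" .
  have "model T' ?N" using U G by (auto simp: open_interp_def)
  then show ?thesis using that 1 2 by blast
qed

section \<open>Densities of sets in random subsets\<close>

definition nsub :: "'a set \<Rightarrow> nat \<Rightarrow> 'a set set" where
  "nsub V n = {S. S \<subseteq> V \<and> card S = n}"

lemma nsub_iff [simp]: "S \<in> nsub V n \<longleftrightarrow> S \<subseteq> V \<and> card S = n"
  by (simp add: nsub_def)

lemma finite_nsub: "finite V \<Longrightarrow> finite (nsub V n)"
  by (simp add: nsub_def)

lemma card_nsub: "finite V \<Longrightarrow> card (nsub V n) = card V choose n"
  by (simp add: nsub_def n_subsets)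

text \<open>If \<open>C\<close> had more than \<open>n\<close> elements, truncated subtraction would
  give \<open>choose 0\<close>, that is 1, for a count of 0.\<close>

lemma card_nsub_superset:
  assumes "finite V" "C \<subseteq> V" "card C \<le> n"
  shows "card {S \<in> nsub V n. C \<subseteq> S} = (card V - card C) choose (n - card C)"
proof -
  have C: "finite C" using assms finite_subset by blast
  have "bij_betw (\<lambda>A. A \<union> C) (nsub (V - C) (n - card C)) {S \<in> nsub V n. C \<subseteq> S}"
  proof (rule bij_betwI[where g = "\<lambda>S. S - C"])
    show "(\<lambda>A. A \<union> C) \<in> nsub (V - C) (n - card C) \<rightarrow> {S \<in> nsub V n. C \<subseteq> S}"
    proof
      fix A assume A: "A \<in> nsub (V - C) (n - card C)"
      then have "finite A" "A \<inter> C = {}" using assms(1) by (auto intro: finite_subset)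
      then have "card (A \<union> C) = n" using A assms(3) C by (simp add: card_Un_disjoint)
      then show "A \<union> C \<in> {S \<in> nsub V n. C \<subseteq> S}" using A assms(2) by auto
    qed
    show "(\<lambda>S. S - C) \<in> {S \<in> nsub V n. C \<subseteq> S} \<rightarrow> nsub (V - C) (n - card C)"
      using C by (auto simp: card_Diff_subset)
  qed auto
  then have "card {S \<in> nsub V n. C \<subseteq> S} = card (nsub (V - C) (n - card C))"
    by (simp add: bij_betw_same_card)
  then show ?thesis
    using assms C by (simp add: card_nsub card_Diff_subset)
qed

text \<open>Negative correlation with denominators cleared: a random \<open>n\<close>-subset of an
  \<open>L\<close>-set contains two disjoint sets of sizes \<open>i\<close> and \<open>j\<close>
  with at most the product of the two probabilities.\<close>

lemma choose_diff_submult: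
  assumes "i + j \<le> n" "n \<le> L"
  shows "((L - (i + j)) choose (n - (i + j))) * (L choose n)
    \<le> ((L - i) choose (n - i)) * ((L - j) choose (n - j))"
  using assms(1)
proof (induction j)
  case (Suc j)
  have step: "(L - m) * ((L - Suc m) choose (n - Suc m)) = (n - m) * ((L - m) choose (n - m))"
    if "Suc m \<le> n" for m
    using times_binomial_minus1_eq[of "n - m" "L - m"] that assms(2) by simp
  let ?b = "\<lambda>m. (L - m) choose (n - m)"
  let ?k = "i + j"
  have IH: "?b ?k * ?b 0 \<le> ?b i * ?b j" using Suc by simp
  have pos: "0 < (L - ?k) * (L - j)" using Suc.prems assms(2) by simp
  \<comment> \<open>Passing from \<open>m\<close> to \<open>Suc m\<close> multiplies
    \<open>?b m\<close> by \<open>(n - m) / (L - m)\<close>, which does not increase with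
    \<open>m\<close> since \<open>n \<le> L\<close>. Here the factors at \<open>i + j\<close> and at
    \<open>j\<close> are compared.\<close>
  have frac: "(n - ?k) * (L - j) \<le> (L - ?k) * (n - j)"
  proof -
    obtain a where a: "n = i + j + a" using Suc.prems by (metis add_Suc_right le_Suc_ex Suc_leD)
    obtain b where b: "L = n + b" using assms(2) le_Suc_ex by blast
    show ?thesis using a b by (simp add: algebra_simps)
  qed
  have "((L - ?k) * (L - j)) * (?b (Suc ?k) * ?b 0)
      = (L - j) * ((L - ?k) * ?b (Suc ?k)) * ?b 0" by (simp only: mult_ac)
  also have "\<dots> = ((n - ?k) * (L - j)) * (?b ?k * ?b 0)"
    using step[of ?k] Suc.prems by (simp add: mult_ac)
  also have "\<dots> \<le> ((L - ?k) * (n - j)) * (?b i * ?b j)"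
    by (rule mult_le_mono[OF frac IH])
  also have "\<dots> = (L - ?k) * ?b i * ((n - j) * ?b j)" by (simp only: mult_ac)
  also have "\<dots> = (L - ?k) * ?b i * ((L - j) * ?b (Suc j))"
    using step[of j] Suc.prems by simp
  also have "\<dots> = ((L - ?k) * (L - j)) * (?b i * ?b (Suc j))" by (simp only: mult_ac)
  finally have "?b (Suc ?k) * ?b 0 \<le> ?b i * ?b (Suc j)"
    using pos by (metis mult_le_cancel1)
  then show ?case by simp
qed simp

lemma sum_card_flip:
  assumes "finite A" "finite B"
  shows "(\<Sum>a\<in>A. card {b\<in>B. R a b}) = (\<Sum>b\<in>B. card {a\<in>A. R a b})"
proof -
  have "(\<Sum>a\<in>A. card {b\<in>B. R a b}) = (\<Sum>a\<in>A. \<Sum>b\<in>B. if R a b then 1 else 0)"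
    using assms by (simp add: sum.If_cases Int_def)
  also have "\<dots> = (\<Sum>b\<in>B. \<Sum>a\<in>A. if R a b then 1 else 0)" by (rule sum.swap)
  also have "\<dots> = (\<Sum>b\<in>B. card {a\<in>A. R a b})"
    using assms by (simp add: sum.If_cases Int_def)
  finally show ?thesis .
qed

text \<open>Union bound over the \<open>k\<close> elements of \<open>A\<close>: a random
  \<open>k\<close>-subset of \<open>S\<close> contains a given one with probability
  \<open>k / card S\<close>.\<close>

lemma card_meeting_pairs:
  assumes "finite S"
  shows "card S * card {(A, B). A \<in> nsub S k \<and> B \<in> nsub S k \<and> A \<inter> B \<noteq> {}}
    \<le> k\<^sup>2 * (card S choose k)\<^sup>2"
proof -
  let ?n = "card S"
  have fin: "finite (nsub S k)" using assms by (rule finite_nsub)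
  have B: "?n * card {B \<in> nsub S k. A \<inter> B \<noteq> {}} \<le> k\<^sup>2 * (?n choose k)" if A: "A \<in> nsub S k" for A
  proof -
    have "{B \<in> nsub S k. A \<inter> B \<noteq> {}} \<subseteq> (\<Union>a\<in>A. {B \<in> nsub S k. {a} \<subseteq> B})" by auto
    then have "card {B \<in> nsub S k. A \<inter> B \<noteq> {}} \<le> card (\<Union>a\<in>A. {B \<in> nsub S k. {a} \<subseteq> B})"
      using fin A assms by (intro card_mono) (auto intro: finite_subset)
    also have "\<dots> \<le> (\<Sum>a\<in>A. card {B \<in> nsub S k. {a} \<subseteq> B})"
      using A assms by (intro card_UN_le) (auto intro: finite_subset)
    also have "\<dots> = (\<Sum>a\<in>A. (?n - 1) choose (k - 1))"
    proof (rule sum.cong[OF refl])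
      fix a assume a: "a \<in> A"
      have "finite A" using A assms finite_subset by auto
      then have "1 \<le> k" using a A by (auto simp: Suc_le_eq card_gt_0_iff)
      then show "card {B \<in> nsub S k. {a} \<subseteq> B} = (?n - 1) choose (k - 1)"
        using card_nsub_superset[of S "{a}" k] assms a A by auto
    qed
    also have "\<dots> = k * ((?n - 1) choose (k - 1))" using A by simp
    finally have "?n * card {B \<in> nsub S k. A \<inter> B \<noteq> {}} \<le> k * (?n * ((?n - 1) choose (k - 1)))"
      by (metis mult.left_commute mult_le_mono2)
    also have "\<dots> = k\<^sup>2 * (?n choose k)"
      using times_binomial_minus1_eq[of k ?n] by (cases "k = 0") (auto simp: power2_eq_square)
    finally show ?thesis .
  qed
  have "{(A, B). A \<in> nsub S k \<and> B \<in> nsub S k \<and> A \<inter> B \<noteq> {}}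
      = (SIGMA A:nsub S k. {B \<in> nsub S k. A \<inter> B \<noteq> {}})" by auto
  then have "?n * card {(A, B). A \<in> nsub S k \<and> B \<in> nsub S k \<and> A \<inter> B \<noteq> {}}
      = (\<Sum>A\<in>nsub S k. ?n * card {B \<in> nsub S k. A \<inter> B \<noteq> {}})"
    using fin by (simp add: sum_distrib_left del: nsub_iff)
  also have "\<dots> \<le> (\<Sum>A\<in>nsub S k. k\<^sup>2 * (?n choose k))" by (intro sum_mono B)
  also have "\<dots> = k\<^sup>2 * (?n choose k)\<^sup>2"
    using assms by (simp add: card_nsub power2_eq_square)
  finally show ?thesis .
qed

text \<open>Disjoint sets are negatively correlated as subsets of a random \<open>n\<close>-set, and pairs that meet
  are a fraction of at most \<open>k\<^sup>2 / n\<close> of all pairs.\<close>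

lemma second_moment_subset_density:
  fixes F :: "'a set set" and c :: real
  assumes "finite V" "F \<subseteq> nsub V k" "2 * k \<le> n" "0 < n" "n \<le> card V"
  defines "X \<equiv> \<lambda>S. real (card {A \<in> F. A \<subseteq> S}) / real (n choose k)"
    and "p \<equiv> real (card F) / real (card V choose k)"
  shows "(\<Sum>S\<in>nsub V n. (X S - c)\<^sup>2) / real (card V choose n) \<le> (p - c)\<^sup>2 + real (k\<^sup>2) / real n"
proof -
  let ?L = "card V"
  let ?D = "nsub V n"
  let ?b = "\<lambda>m. (?L - m) choose (n - m)"
  have fin: "finite ?D" "finite F" "finite (nsub V k)"
    using assms(1,2) finite_nsub finite_subset by metis+
  have cD: "card ?D = ?L choose n" using assms(1) by (rule card_nsub)
  have L0: "0 < ?L choose n" and n0: "0 < n choose k" and k0: "0 < ?L choose k"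
    using assms by auto
  \<comment> \<open>Choosing an \<open>n\<close>-set and a \<open>k\<close>-set inside it amounts to
    choosing the \<open>k\<close>-set and extending it. This makes the mean of \<open>X\<close>
    equal to \<open>p\<close>.\<close>
  have cm: "(?L choose n) * (n choose k) = (?L choose k) * ?b k"
    using assms by (intro choose_mult) auto
  have p: "p * real (?L choose n) * real (n choose k) = real (card F) * real (?b k)"
  proof -
    have "p * real (?L choose n) * real (n choose k) = p * real ((?L choose n) * (n choose k))"
      by simp
    also have "\<dots> = p * real (?L choose k) * real (?b k)" unfolding cm by simp
    also have "p * real (?L choose k) = card F" using k0 by (simp add: p_def)
    finally show ?thesis .
  qed
  have "(\<Sum>S\<in>?D. card {A \<in> F. A \<subseteq> S}) = (\<Sum>A\<in>F. card {S \<in> ?D. A \<subseteq> S})"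
    using fin by (intro sum_card_flip)
  also have "\<dots> = (\<Sum>A\<in>F. ?b k)"
    using assms(2,3) card_nsub_superset[OF assms(1)] by (intro sum.cong) (force simp: subset_iff)+
  finally have m1: "(\<Sum>S\<in>?D. card {A \<in> F. A \<subseteq> S}) = card F * ?b k" by simp
  have "(\<Sum>S\<in>?D. X S) = real (\<Sum>S\<in>?D. card {A \<in> F. A \<subseteq> S}) / real (n choose k)"
    by (simp add: X_def sum_divide_distrib)
  then have EX: "(\<Sum>S\<in>?D. X S) = p * real (?L choose n)"
    using n0 unfolding m1 of_nat_mult p[symmetric] by simp
  define Dj where "Dj = {(A, B). A \<in> F \<and> B \<in> F \<and> A \<inter> B = {}}"
  have DjF: "Dj \<subseteq> F \<times> F" by (auto simp: Dj_def)
  have finDj: "finite Dj" using fin DjF finite_subset by blast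
  have cDj: "card Dj \<le> (card F)\<^sup>2"
    using card_mono[OF _ DjF] fin by (simp add: card_cartesian_product power2_eq_square)
  \<comment> \<open>The square counts ordered pairs of members of \<open>F\<close> inside
    \<open>S\<close>. Disjoint pairs are kept for averaging over \<open>S\<close>; pairs that meet
    are bounded for each \<open>S\<close> separately, whatever \<open>F\<close> is.\<close>
  have split: "real ((card {A \<in> F. A \<subseteq> S})\<^sup>2)
      \<le> real (card {(A, B) \<in> Dj. A \<subseteq> S \<and> B \<subseteq> S}) + real (k\<^sup>2 * (n choose k)\<^sup>2) / real n"
    if S: "S \<in> ?D" for S
  proof -
    let ?M = "{(A, B). A \<in> nsub S k \<and> B \<in> nsub S k \<and> A \<inter> B \<noteq> {}}"
    have finS: "finite S" using S assms(1) finite_subset by auto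
    have "?M \<subseteq> nsub S k \<times> nsub S k" by auto
    then have finM: "finite ?M" using finite_nsub[OF finS] finite_subset by blast
    have "{A \<in> F. A \<subseteq> S} \<times> {A \<in> F. A \<subseteq> S} \<subseteq> {(A, B) \<in> Dj. A \<subseteq> S \<and> B \<subseteq> S} \<union> ?M"
      using assms(2) by (auto simp: Dj_def)
    moreover have "finite ({(A, B) \<in> Dj. A \<subseteq> S \<and> B \<subseteq> S} \<union> ?M)"
      using finDj finM by (auto intro: finite_subset[of _ Dj])
    ultimately have "card ({A \<in> F. A \<subseteq> S} \<times> {A \<in> F. A \<subseteq> S})
        \<le> card ({(A, B) \<in> Dj. A \<subseteq> S \<and> B \<subseteq> S} \<union> ?M)" by (rule card_mono[rotated])
    also have "\<dots> \<le> card {(A, B) \<in> Dj. A \<subseteq> S \<and> B \<subseteq> S} + card ?M" by (rule card_Un_le)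
    finally have "real ((card {A \<in> F. A \<subseteq> S})\<^sup>2)
        \<le> real (card {(A, B) \<in> Dj. A \<subseteq> S \<and> B \<subseteq> S}) + real (card ?M)"
      unfolding card_cartesian_product power2_eq_square by linarith
    moreover have "real n * real (card ?M) \<le> real (k\<^sup>2 * (n choose k)\<^sup>2)"
      using card_meeting_pairs[OF finS, of k] S unfolding nsub_iff
      by (simp flip: of_nat_mult of_nat_power)
    then have "real (card ?M) \<le> real (k\<^sup>2 * (n choose k)\<^sup>2) / real n"
      using assms(4) by (simp add: field_simps)
    ultimately show ?thesis by linarith
  qed
  have "(\<Sum>S\<in>?D. card {(A, B) \<in> Dj. A \<subseteq> S \<and> B \<subseteq> S})
      = (\<Sum>P\<in>Dj. card {S \<in> ?D. fst P \<subseteq> S \<and> snd P \<subseteq> S})"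
    using sum_card_flip[OF fin(1) finDj, of "\<lambda>S P. fst P \<subseteq> S \<and> snd P \<subseteq> S"]
    by (simp add: case_prod_unfold)
  also have "\<dots> = (\<Sum>P\<in>Dj. ?b (2 * k))"
  proof (rule sum.cong[OF refl])
    fix P assume P: "P \<in> Dj"
    then have "fst P \<in> F" "snd P \<in> F" and disj: "fst P \<inter> snd P = {}"
      by (auto simp: Dj_def)
    then have AB: "fst P \<in> nsub V k" "snd P \<in> nsub V k"
      using assms(2) by blast+
    then have "card (fst P \<union> snd P) = 2 * k"
      using assms(1) disj by (subst card_Un_disjoint) (auto intro: finite_subset)
    then show "card {S \<in> ?D. fst P \<subseteq> S \<and> snd P \<subseteq> S} = ?b (2 * k)"
      using card_nsub_superset[OF assms(1), of "fst P \<union> snd P" n] AB assms(3) by simp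
  qed
  finally have m2: "(\<Sum>S\<in>?D. card {(A, B) \<in> Dj. A \<subseteq> S \<and> B \<subseteq> S}) = card Dj * ?b (2 * k)" by simp
  have "(card Dj * ?b (2 * k)) * (?L choose n) \<le> (card F)\<^sup>2 * (?b k * ?b k)"
    using choose_diff_submult[of k k n ?L] assms(3,5) cDj
    by (simp only: mult.assoc mult_2 mult_le_mono)
  then have "real ((card Dj * ?b (2 * k)) * (?L choose n)) \<le> real ((card F)\<^sup>2 * (?b k * ?b k))"
    by (rule of_nat_mono)
  then have "real (card Dj * ?b (2 * k)) * real (?L choose n) \<le> (real (card F) * real (?b k))\<^sup>2"
    by (simp add: power2_eq_square mult_ac)
  also have "\<dots> = (p * real (n choose k))\<^sup>2 * real (?L choose n) * real (?L choose n)"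
    unfolding p[symmetric] by (simp add: power2_eq_square)
  finally have m2': "real (card Dj * ?b (2 * k)) \<le> (p * real (n choose k))\<^sup>2 * real (?L choose n)"
    using L0 by simp
  have "(\<Sum>S\<in>?D. (X S)\<^sup>2) = (\<Sum>S\<in>?D. real ((card {A \<in> F. A \<subseteq> S})\<^sup>2)) / (real (n choose k))\<^sup>2"
    by (simp add: X_def sum_divide_distrib power_divide)
  also have "\<dots> \<le> (\<Sum>S\<in>?D. real (card {(A, B) \<in> Dj. A \<subseteq> S \<and> B \<subseteq> S})
      + real (k\<^sup>2 * (n choose k)\<^sup>2) / real n) / (real (n choose k))\<^sup>2"
    by (intro divide_right_mono sum_mono split) auto
  also have "\<dots> = (real (card Dj * ?b (2 * k))
      + real (?L choose n) * (real (k\<^sup>2 * (n choose k)\<^sup>2) / real n)) / (real (n choose k))\<^sup>2"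
    unfolding sum.distrib m2[symmetric] by (simp add: cD)
  also have "\<dots> \<le> ((p * real (n choose k))\<^sup>2 * real (?L choose n)
      + real (?L choose n) * (real (k\<^sup>2 * (n choose k)\<^sup>2) / real n)) / (real (n choose k))\<^sup>2"
    using m2' by (intro divide_right_mono add_right_mono) auto
  also have "\<dots> = (p\<^sup>2 + real (k\<^sup>2) / real n) * real (?L choose n)"
    using n0 assms(4) by (simp add: field_simps power2_eq_square)
  finally have EX2: "(\<Sum>S\<in>?D. (X S)\<^sup>2) \<le> (p\<^sup>2 + real (k\<^sup>2) / real n) * real (?L choose n)" .
  \<comment> \<open>The centre is an arbitrary \<open>c\<close> and not the mean \<open>p\<close>:
    later \<open>c\<close> is the limit value, \<open>p\<close> the density in a finite model, and
    the error \<open>(p - c)\<^sup>2\<close> vanishes in the limit.\<close>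
  have "(\<Sum>S\<in>?D. (X S - c)\<^sup>2) = (\<Sum>S\<in>?D. (X S)\<^sup>2) - 2 * c * (\<Sum>S\<in>?D. X S) + c\<^sup>2 * real (?L choose n)"
    by (simp add: power2_diff sum.distrib sum_subtractf sum_distrib_left cD algebra_simps)
  also have "\<dots> \<le> ((p - c)\<^sup>2 + real (k\<^sup>2) / real n) * real (?L choose n)"
    using EX2 unfolding EX by (simp add: power2_eq_square algebra_simps)
  finally show ?thesis using L0 by (simp add: field_simps)
qed

section \<open>Isomorphism classes and densities\<close>

definition cls :: "thy \<Rightarrow> struct \<Rightarrow> struct set" where
  "cls T K = {L. finite_model T L \<and> struct_iso K L}"

definition classes :: "thy \<Rightarrow> nat \<Rightarrow> struct set set" where
  "classes T n = {M \<in> iso_classes T. class_size M = n}"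

text \<open>The same choice as in \<open>class_size\<close>, so that the size of a class is that of
  its representative by definition.\<close>

definition rep :: "struct set \<Rightarrow> struct" where
  "rep M = (SOME K. K \<in> M)"

lemma mem_cls_self: "finite_model T K \<Longrightarrow> K \<in> cls T K"
  by (simp add: cls_def struct_iso_refl)

lemma iso_classes_eq: "iso_classes T = cls T ` {K. finite_model T K}"
  by (auto simp: iso_classes_def cls_def quotient_def)

lemma cls_in_iso_classes: "finite_model T K \<Longrightarrow> cls T K \<in> iso_classes T"
  by (simp add: iso_classes_eq)

lemma cls_cong:
  assumes "struct_iso K L"
  shows "cls T K = cls T L"
  using assms struct_iso_trans struct_iso_sym unfolding cls_def by blast

lemma mem_class:
  assumes "M \<in> iso_classes T" "K \<in> M"
  shows "finite_model T K" "M = cls T K"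
  using assms cls_cong by (auto simp: iso_classes_eq cls_def)

lemma mem_class_iff:
  assumes "M \<in> iso_classes T" "finite_model T K"
  shows "K \<in> M \<longleftrightarrow> cls T K = M"
  using assms mem_class mem_cls_self by blast

lemma rep_in: "M \<in> iso_classes T \<Longrightarrow> rep M \<in> M"
  unfolding rep_def by (rule someI_ex) (auto simp: iso_classes_eq intro: mem_cls_self)

lemma finite_model_rep: "M \<in> iso_classes T \<Longrightarrow> finite_model T (rep M)"
  using rep_in mem_class by blast

lemma cls_rep: "M \<in> iso_classes T \<Longrightarrow> cls T (rep M) = M"
  using rep_in mem_class by blast

lemma struct_iso_rep_cls: "finite_model T K \<Longrightarrow> struct_iso K (rep (cls T K))"
  using rep_in[OF cls_in_iso_classes] by (auto simp: cls_def)

lemma class_size_rep: "class_size M = card (verts (rep M))"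
  by (simp add: class_size_def rep_def)

lemma class_size_cls: "finite_model T K \<Longrightarrow> class_size (cls T K) = card (verts K)"
  using struct_iso_card[OF struct_iso_rep_cls] by (simp add: class_size_rep)

lemma cls_in_classes: "finite_model T K \<Longrightarrow> card (verts K) = n \<Longrightarrow> cls T K \<in> classes T n"
  by (simp add: classes_def cls_in_iso_classes class_size_cls)

lemma finite_model_induced:
  "finite_model T K \<Longrightarrow> S \<subseteq> verts K \<Longrightarrow> finite_model T (induced K S)"
  by (auto simp: finite_model_def model_induced intro: finite_subset)

lemma finite_model_interp_struct:
  "open_interp T S I \<Longrightarrow> finite_model S K \<Longrightarrow> finite_model T (interp_struct T I K)"
  by (simp add: finite_model_def open_interp_def)

lemma finite_structures:
  assumes "finite (preds T)" "finite V"
  shows "finite {K. structure_of T K \<and> verts K = V}"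
proof -
  let ?A = "{K. structure_of T K \<and> verts K = V}"
  let ?h = "\<lambda>K. restrict (rel K) (preds T)"
  have "?h ` ?A \<subseteq> (\<Pi>\<^sub>E P\<in>preds T. Pow {xs. set xs \<subseteq> V \<and> length xs = arity T P})"
    unfolding image_subset_iff restrict_PiE_iff structure_of_def by blast
  moreover have "finite (\<Pi>\<^sub>E P\<in>preds T. Pow {xs. set xs \<subseteq> V \<and> length xs = arity T P})"
    using assms by (intro finite_PiE) (auto intro: finite_lists_length_eq)
  moreover have "inj_on ?h ?A"
  proof (rule inj_onI)
    fix K L assume K: "K \<in> ?A" and L: "L \<in> ?A" and eq: "?h K = ?h L"
    have "rel K P = rel L P" for P
      using K L fun_cong[OF eq, of P] by (cases "P \<in> preds T") (auto simp: structure_of_def)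
    then show "K = L"
      using K L by (intro struct.equality) auto
  qed
  ultimately show ?thesis by (meson finite_imageD finite_subset)
qed

text \<open>Each class has a member on \<open>{..<n}\<close>, and a finite language admits only
  finitely many structures there.\<close>

lemma finite_classes:
  assumes "finite (preds T)"
  shows "finite (classes T n)"
proof -
  have "classes T n \<subseteq> cls T ` {K. structure_of T K \<and> verts K = {..<n}}"
  proof
    fix M assume "M \<in> classes T n"
    then have M: "M \<in> iso_classes T" and n: "card (verts (rep M)) = n"
      by (auto simp: classes_def class_size_rep)
    have fin: "finite (verts (rep M))" and mod: "model T (rep M)"
      using finite_model_rep[OF M] by (auto simp: finite_model_def)
    obtain f where f: "bij_betw f (verts (rep M)) {..<n}"
      using ex_bij_betw_finite_nat[OF fin] n by (auto simp: atLeast0LessThan)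
    obtain L where L: "model T L" "iso_by f (rep M) L" "verts L = f ` verts (rep M)"
      using model_transport[OF mod] f by (metis bij_betw_def)
    have "struct_iso (rep M) L" using L(2) struct_iso_iff by blast
    then have "cls T L = M"
      using cls_cong[of "rep M" L T] cls_rep[OF M] by simp
    moreover have "structure_of T L" "verts L = {..<n}"
      using L(1,3) f by (simp_all add: model_def bij_betw_def)
    ultimately show "M \<in> cls T ` {K. structure_of T K \<and> verts K = {..<n}}" by blast
  qed
  then show ?thesis
    by (rule finite_subset) (intro finite_imageI finite_structures assms finite_lessThan)
qed

lemma iso_classes_UN: "iso_classes T = (\<Union>n. classes T n)"
  by (auto simp: classes_def)

lemma countable_iso_classes: "finite (preds T) \<Longrightarrow> countable (iso_classes T)"
  unfolding iso_classes_UN by (rule countable_UN) (auto intro: countable_finite finite_classes)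

text \<open>Puts the density as the probability that the class of a random induced substructure is
  \<open>M\<close>, so the densities of all \<open>M\<close> of one size form the distribution of
  one random variable.\<close>

lemma density_eq:
  assumes "M \<in> classes T k" "finite_model T G"
  shows "density M G = real (card {S \<in> nsub (verts G) k. cls T (induced G S) = M})
    / real (card (verts G) choose k)"
proof -
  have "M \<in> iso_classes T" "class_size M = k" using assms(1) by (auto simp: classes_def)
  then have "{S. S \<subseteq> verts G \<and> card S = class_size M \<and> induced G S \<in> M}
      = {S \<in> nsub (verts G) k. cls T (induced G S) = M}"
    using mem_class_iff[of M T] finite_model_induced[OF assms(2)] by auto
  then show ?thesis by (simp add: density_def \<open>class_size M = k\<close>)
qed

lemma density_nonneg: "0 \<le> density M G"
  by (simp add: density_def)

lemma density_le_1:
  assumes "finite (verts G)"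
  shows "density M G \<le> 1"
proof -
  have "card {S. S \<subseteq> verts G \<and> card S = class_size M \<and> induced G S \<in> M}
      \<le> card (nsub (verts G) (class_size M))"
    using assms by (intro card_mono finite_nsub) auto
  then show ?thesis
    using assms by (auto simp: density_def card_nsub divide_le_eq_1)
qed

text \<open>An isomorphism sends the subsets counted in \<open>K\<close> injectively to subsets
  counted in \<open>L\<close>; the reverse inequality comes from the inverse isomorphism.\<close>

lemma density_struct_iso:
  assumes "finite_model T K" "finite_model T L" "struct_iso K L" "M \<in> iso_classes T"
  shows "density M K = density M L"
proof -
  let ?A = "\<lambda>K. {S. S \<subseteq> verts K \<and> card S = class_size M \<and> induced K S \<in> M}"
  have le: "card (?A K) \<le> card (?A L)"
    if fK: "finite_model T K" and fL: "finite_model T L" and iso: "struct_iso K L" for K L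
  proof -
    obtain f where f: "iso_by f K L" using iso struct_iso_iff by blast
    have inj: "inj_on f (verts K)" using f by (simp add: iso_by_def bij_betw_def)
    have "image f ` ?A K \<subseteq> ?A L"
    proof (rule image_subsetI)
      fix S assume S: "S \<in> ?A K"
      then have sub: "f ` S \<subseteq> verts L" using iso_by_verts[OF f] by auto
      then have "finite_model T (induced L (f ` S))" by (rule finite_model_induced[OF fL])
      moreover have "struct_iso (induced K S) (induced L (f ` S))"
        using iso_by_induced[OF f] S struct_iso_iff by blast
      moreover have "M = cls T (induced K S)" using S mem_class[OF assms(4)] by blast
      ultimately have "induced L (f ` S) \<in> M" by (simp add: cls_def)
      moreover have "card (f ` S) = class_size M"
        using S inj_on_subset[OF inj] by (auto simp: card_image)
      ultimately show "f ` S \<in> ?A L" using sub by blast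
    qed
    moreover have "inj_on (image f) (?A K)"
      using inj_on_image_Pow[OF inj] by (rule inj_on_subset) auto
    moreover have "finite (?A L)" using fL by (simp add: finite_model_def)
    ultimately show ?thesis by (intro card_inj_on_le)
  qed
  have "card (?A K) = card (?A L)"
    using le[OF assms(1-3)] le[OF assms(2,1) struct_iso_sym[OF assms(3)]] by simp
  then show ?thesis by (simp add: density_def struct_iso_card[OF assms(3)])
qed

text \<open>Averaging over classes weighted by density is averaging over random
  \<open>n\<close>-subsets. Through this identity the counting estimates for subsets reach
  densities.\<close>

lemma sum_density:
  fixes f :: "struct set \<Rightarrow> real"
  assumes "finite (preds T)" "finite_model T G"
  shows "(\<Sum>M\<in>classes T n. density M G * f M)
    = (\<Sum>S\<in>nsub (verts G) n. f (cls T (induced G S))) / real (card (verts G) choose n)"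
proof -
  let ?D = "nsub (verts G) n" and ?g = "\<lambda>S. cls T (induced G S)"
  have fin: "finite ?D" using assms(2) by (simp add: finite_model_def finite_nsub)
  have "?g ` ?D \<subseteq> classes T n"
    using finite_model_induced[OF assms(2)] by (auto intro!: cls_in_classes)
  then have "(\<Sum>S\<in>?D. f (?g S)) = (\<Sum>M\<in>classes T n. \<Sum>S\<in>{S\<in>?D. ?g S = M}. f (?g S))"
    using fin finite_classes[OF assms(1)] by (intro sum.group[symmetric])
  also have "\<dots> = (\<Sum>M\<in>classes T n. real (card {S\<in>?D. ?g S = M}) * f M)"
    by (intro sum.cong refl) simp
  finally show ?thesis
    using density_eq[OF _ assms(2)] by (simp add: sum_divide_distrib del: nsub_iff)
qed

section \<open>Interpretations acting on classes and densities\<close>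

definition interp_class :: "thy \<Rightarrow> interp \<Rightarrow> struct set \<Rightarrow> struct set" where
  "interp_class T I N = cls T (interp_struct T I (rep N))"

lemma interp_class_cls:
  assumes "open_interp T S I" "finite_model S K"
  shows "interp_class T I (cls S K) = cls T (interp_struct T I K)"
proof -
  obtain f where "iso_by f K (rep (cls S K))"
    using struct_iso_rep_cls[OF assms(2)] struct_iso_iff by blast
  then have "struct_iso (interp_struct T I K) (interp_struct T I (rep (cls S K)))"
    using iso_by_interp_struct open_interp_fv_bounded[OF assms(1)] struct_iso_iff by blast
  then show ?thesis unfolding interp_class_def by (rule cls_cong[symmetric])
qed

lemma interp_class_in_classes:
  assumes "open_interp T S I" "N \<in> classes S n"
  shows "interp_class T I N \<in> classes T n"
  using assms unfolding interp_class_def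
  by (intro cls_in_classes finite_model_interp_struct[OF assms(1)] finite_model_rep)
    (auto simp: classes_def class_size_rep)

text \<open>All members of a class have isomorphic reducts, so the existential in
  \<open>pullback\<close> becomes an equation. On each size, \<open>pullback\<close> is the image of
  a distribution under \<open>interp_class T I\<close>.\<close>

lemma pullback_eq:
  assumes "open_interp T S I" "M \<in> classes T n"
  shows "pullback T S I \<phi> M = (\<Sum>N | N \<in> classes S n \<and> interp_class T I N = M. \<phi> N)"
proof -
  have M: "M \<in> iso_classes T" "class_size M = n" using assms(2) by (auto simp: classes_def)
  have "(\<exists>K\<in>N. interp_struct T I K \<in> M) \<longleftrightarrow> interp_class T I N = M" if N: "N \<in> iso_classes S" for N
  proof -
    have "interp_struct T I K \<in> M \<longleftrightarrow> interp_class T I N = M" if "K \<in> N" for K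
      using mem_class[OF N that] interp_class_cls[OF assms(1), of K]
        mem_class_iff[OF M(1) finite_model_interp_struct[OF assms(1), of K]] by simp
    then show ?thesis using rep_in[OF N] by blast
  qed
  then have "{N. N \<in> iso_classes S \<and> class_size N = class_size M \<and> (\<exists>K\<in>N. interp_struct T I K \<in> M)}
      = {N. N \<in> classes S n \<and> interp_class T I N = M}"
    by (auto simp: classes_def M)
  then show ?thesis using M by (simp add: pullback_def)
qed

text \<open>The finite counterpart of \<open>pullback\<close>: a random subset of the reduct induces
  the reduct of what it induces in \<open>G\<close>.\<close>

lemma density_interp_struct:
  assumes "open_interp T S I" "finite (preds S)" "finite_model S G" "M \<in> classes T n"
  shows "density M (interp_struct T I G)
    = (\<Sum>N | N \<in> classes S n \<and> interp_class T I N = M. density N G)"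
proof -
  let ?D = "nsub (verts G) n"
  have fin: "finite ?D" using assms(3) by (simp add: finite_model_def finite_nsub)
  have eq: "interp_class T I (cls S (induced G A)) = cls T (induced (interp_struct T I G) A)"
    if "A \<in> ?D" for A
    using that interp_class_cls[OF assms(1) finite_model_induced[OF assms(3)]]
      induced_interp_struct[OF open_interp_fv_bounded[OF assms(1)]] by simp
  have "(\<Sum>N | N \<in> classes S n \<and> interp_class T I N = M. density N G)
      = (\<Sum>N\<in>classes S n. density N G * of_bool (interp_class T I N = M))"
    using finite_classes[OF assms(2)] by (simp add: sum.inter_filter of_bool_def if_distrib cong: if_cong)
  also have "\<dots> = (\<Sum>A\<in>?D. of_bool (cls T (induced (interp_struct T I G) A) = M))
      / real (card (verts G) choose n)"
    unfolding sum_density[OF assms(2,3)] using eq by (simp cong: sum.cong del: nsub_iff)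
  also have "\<dots> = density M (interp_struct T I G)"
    using density_eq[OF assms(4) finite_model_interp_struct[OF assms(1,3)]] fin
    by (simp add: of_bool_def sum.If_cases Int_def del: nsub_iff)
  finally show ?thesis by simp
qed

text \<open>Change of variables for an image distribution.\<close>

lemma sum_pullback:
  fixes u :: "struct set \<Rightarrow> real"
  assumes "open_interp T S I" "finite (preds T)" "finite (preds S)"
  shows "(\<Sum>M\<in>classes T n. pullback T S I \<phi> M * u M)
    = (\<Sum>N\<in>classes S n. \<phi> N * u (interp_class T I N))"
proof -
  have "(\<Sum>N\<in>classes S n. \<phi> N * u (interp_class T I N))
      = (\<Sum>M\<in>classes T n. \<Sum>N\<in>{N\<in>classes S n. interp_class T I N = M}. \<phi> N * u (interp_class T I N))"
    using finite_classes assms interp_class_in_classes[OF assms(1)]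
    by (intro sum.group[symmetric]) auto
  also have "\<dots> = (\<Sum>M\<in>classes T n. pullback T S I \<phi> M * u M)"
    using pullback_eq[OF assms(1)] by (intro sum.cong) (auto simp: sum_distrib_right)
  finally show ?thesis by simp
qed

section \<open>Typical finite models\<close>

lemma Hom_plus_nonneg:
  assumes "\<phi> \<in> Hom_plus T" "M \<in> classes T n"
  shows "0 \<le> \<phi> M"
  using assms by (auto simp: Hom_plus_def classes_def dest: PiE_mem)

lemma Hom_plus_obtain:
  assumes "\<phi> \<in> Hom_plus T"
  obtains N where "\<And>m. finite_model T (N m)" "\<And>m. m \<le> card (verts (N m))"
    "\<And>n M. M \<in> classes T n \<Longrightarrow> (\<lambda>m. density M (N m)) \<longlonglongrightarrow> \<phi> M"
proof -
  obtain N where "\<forall>m. finite_model T (N m)" "strict_mono (\<lambda>m. card (verts (N m)))"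
    "\<forall>M\<in>iso_classes T. (\<lambda>m. density M (N m)) \<longlonglongrightarrow> \<phi> M"
    using assms by (auto simp: Hom_plus_def)
  then show ?thesis
    using that[of N] seq_suble by (auto simp: classes_def)
qed

text \<open>In a model with at least \<open>n\<close> vertices the densities of size
  \<open>n\<close> sum to 1, and a sum over finitely many classes passes to the limit.\<close>

lemma Hom_plus_sum:
  assumes "\<phi> \<in> Hom_plus T" "finite (preds T)"
  shows "(\<Sum>M\<in>classes T n. \<phi> M) = 1"
proof -
  obtain N where N: "\<And>m. finite_model T (N m)" "\<And>m. m \<le> card (verts (N m))"
    "\<And>n M. M \<in> classes T n \<Longrightarrow> (\<lambda>m. density M (N m)) \<longlonglongrightarrow> \<phi> M"
    using Hom_plus_obtain[OF assms(1)] by blast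
  have "(\<Sum>M\<in>classes T n. density M (N m)) = 1" if "n \<le> m" for m
  proof -
    have "finite (verts (N m))" using N(1) by (simp add: finite_model_def)
    moreover have "n \<le> card (verts (N m))" using that N(2)[of m] by simp
    ultimately show ?thesis
      using sum_density[OF assms(2) N(1), where f = "\<lambda>_. 1"] by (simp add: card_nsub)
  qed
  then have "(\<lambda>m. \<Sum>M\<in>classes T n. density M (N m)) \<longlonglongrightarrow> 1"
    by (intro tendsto_eventually eventually_sequentiallyI)
  moreover have "(\<lambda>m. \<Sum>M\<in>classes T n. density M (N m)) \<longlonglongrightarrow> (\<Sum>M\<in>classes T n. \<phi> M)"
    by (intro tendsto_sum N(3))
  ultimately show ?thesis using LIMSEQ_unique by blast
qed

text \<open>Two-stage sampling: a random \<open>n\<close>-subset of \<open>G\<close> first, then the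
  density of \<open>M\<close> inside it. The family \<open>F\<close> consists of the
  \<open>k\<close>-subsets of \<open>G\<close> that induce \<open>M\<close>.\<close>

lemma density_second_moment:
  assumes "finite (preds T)" "finite_model T G" "M \<in> classes T k"
    and "2 * k \<le> n" "0 < n" "n \<le> card (verts G)"
  shows "(\<Sum>K\<in>classes T n. density K G * (density M (rep K) - c)\<^sup>2)
    \<le> (density M G - c)\<^sup>2 + real (k\<^sup>2) / real n"
proof -
  define F where "F = {A \<in> nsub (verts G) k. cls T (induced G A) = M}"
  have fin: "finite (verts G)" using assms(2) by (simp add: finite_model_def)
  have M: "M \<in> iso_classes T" using assms(3) by (simp add: classes_def)
  have eq: "density M (rep (cls T (induced G S))) = real (card {A \<in> F. A \<subseteq> S}) / real (n choose k)"
    if S: "S \<in> nsub (verts G) n" for S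
  proof -
    have fm: "finite_model T (induced G S)" using S finite_model_induced[OF assms(2)] by simp
    have "density M (rep (cls T (induced G S))) = density M (induced G S)"
      using density_struct_iso[OF fm finite_model_rep struct_iso_rep_cls[OF fm] M]
        cls_in_iso_classes[OF fm] by simp
    also have "{A \<in> nsub S k. cls T (induced (induced G S) A) = M} = {A \<in> F. A \<subseteq> S}"
      using S by (auto simp: F_def induced_induced)
    then have "density M (induced G S) = real (card {A \<in> F. A \<subseteq> S}) / real (n choose k)"
      using density_eq[OF assms(3) fm] S by simp
    finally show ?thesis .
  qed
  have "(\<Sum>K\<in>classes T n. density K G * (density M (rep K) - c)\<^sup>2)
      = (\<Sum>S\<in>nsub (verts G) n. (density M (rep (cls T (induced G S))) - c)\<^sup>2)
        / real (card (verts G) choose n)"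
    by (rule sum_density[OF assms(1,2)])
  also have "\<dots> = (\<Sum>S\<in>nsub (verts G) n. (real (card {A \<in> F. A \<subseteq> S}) / real (n choose k) - c)\<^sup>2)
        / real (card (verts G) choose n)"
    using eq by (simp cong: sum.cong del: nsub_iff)
  also have "\<dots> \<le> (real (card F) / real (card (verts G) choose k) - c)\<^sup>2 + real (k\<^sup>2) / real n"
    using assms(4-6) fin by (intro second_moment_subset_density) (auto simp: F_def)
  also have "real (card F) / real (card (verts G) choose k) = density M G"
    using density_eq[OF assms(3,2)] by (simp add: F_def)
  finally show ?thesis .
qed

text \<open>The finite estimate is centred at \<open>\<phi> M\<close> from the start; along the
  defining sequence its first error term tends to 0 and only \<open>k\<^sup>2 / n\<close>
  remains.\<close>

lemma Hom_plus_variance: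
  assumes "\<phi> \<in> Hom_plus T" "finite (preds T)" "M \<in> classes T k" "2 * k \<le> n" "0 < n"
  shows "(\<Sum>K\<in>classes T n. \<phi> K * (density M (rep K) - \<phi> M)\<^sup>2) \<le> real (k\<^sup>2) / real n"
proof -
  obtain N where N: "\<And>m. finite_model T (N m)" "\<And>m. m \<le> card (verts (N m))"
    "\<And>n M. M \<in> classes T n \<Longrightarrow> (\<lambda>m. density M (N m)) \<longlonglongrightarrow> \<phi> M"
    using Hom_plus_obtain[OF assms(1)] by blast
  have "(\<lambda>m. \<Sum>K\<in>classes T n. density K (N m) * (density M (rep K) - \<phi> M)\<^sup>2)
      \<longlonglongrightarrow> (\<Sum>K\<in>classes T n. \<phi> K * (density M (rep K) - \<phi> M)\<^sup>2)"
    by (intro tendsto_intros N(3))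
  moreover have "(\<lambda>m. (density M (N m) - \<phi> M)\<^sup>2 + real (k\<^sup>2) / real n)
      \<longlonglongrightarrow> (\<phi> M - \<phi> M)\<^sup>2 + real (k\<^sup>2) / real n"
    by (intro tendsto_intros N(3)[OF assms(3)])
  moreover have "\<exists>m0. \<forall>m\<ge>m0. (\<Sum>K\<in>classes T n. density K (N m) * (density M (rep K) - \<phi> M)\<^sup>2)
      \<le> (density M (N m) - \<phi> M)\<^sup>2 + real (k\<^sup>2) / real n"
    using density_second_moment[OF assms(2) N(1) assms(3-5)] N(2) le_trans by meson
  ultimately have "(\<Sum>K\<in>classes T n. \<phi> K * (density M (rep K) - \<phi> M)\<^sup>2)
      \<le> (\<phi> M - \<phi> M)\<^sup>2 + real (k\<^sup>2) / real n"
    by (rule LIMSEQ_le)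
  then show ?thesis by simp
qed

definition typical :: "(struct set \<Rightarrow> real) \<Rightarrow> struct set set \<Rightarrow> real \<Rightarrow> struct \<Rightarrow> bool" where
  "typical \<phi> F e K \<longleftrightarrow> (\<forall>M\<in>F. \<bar>density M K - \<phi> M\<bar> < e)"

lemma atypical_measure_less_half:
  assumes "\<phi> \<in> Hom_plus T" "finite (preds T)" "finite F" "F \<subseteq> iso_classes T" "0 < e"
  shows "\<forall>\<^sub>F n in sequentially. (\<Sum>K\<in>{K \<in> classes T n. \<not> typical \<phi> F e (rep K)}. \<phi> K) < 1 / 2"
proof -
  \<comment> \<open>The variance bounds for the members of \<open>F\<close> add up to
    \<open>C / n\<close>; dividing by \<open>e\<^sup>2\<close> gives Chebyshev's bound for all of
    \<open>F\<close> at once.\<close>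
  define C where "C = (\<Sum>M\<in>F. real ((class_size M)\<^sup>2))"
  have "(\<lambda>n. C / real n / e\<^sup>2) \<longlonglongrightarrow> 0 / e\<^sup>2"
    by (intro tendsto_intros lim_const_over_n) (use assms(5) in auto)
  then have "\<forall>\<^sub>F n in sequentially. C / real n / e\<^sup>2 < 1 / 2"
    by (rule order_tendstoD) auto
  moreover have "\<forall>\<^sub>F n in sequentially. \<forall>M\<in>F. 2 * class_size M \<le> n"
    using assms(3) by (auto intro!: eventually_ball_finite eventually_ge_at_top)
  moreover have "\<forall>\<^sub>F n in sequentially. 0 < (n::nat)" by (rule eventually_gt_at_top)
  ultimately show ?thesis
  proof eventually_elim
    case (elim n)
    let ?C = "classes T n" and ?d = "\<lambda>K M. (density M (rep K) - \<phi> M)\<^sup>2"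
    have fin: "finite ?C" by (rule finite_classes[OF assms(2)])
    have nn: "\<And>K. K \<in> ?C \<Longrightarrow> 0 \<le> \<phi> K" using Hom_plus_nonneg[OF assms(1)] .
    have "(\<Sum>K\<in>{K \<in> ?C. \<not> typical \<phi> F e (rep K)}. \<phi> K)
        \<le> (\<Sum>K\<in>{K \<in> ?C. \<not> typical \<phi> F e (rep K)}. \<phi> K * (\<Sum>M\<in>F. ?d K M) / e\<^sup>2)"
    proof (rule sum_mono)
      fix K assume "K \<in> {K \<in> ?C. \<not> typical \<phi> F e (rep K)}"
      then obtain M where K: "K \<in> ?C" and M: "M \<in> F" and ge: "e \<le> \<bar>density M (rep K) - \<phi> M\<bar>"
        by (auto simp: typical_def not_less)
      have "e\<^sup>2 \<le> ?d K M" using ge assms(5) by (metis abs_ge_self abs_le_square_iff abs_of_pos)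
      also have "\<dots> \<le> (\<Sum>M\<in>F. ?d K M)" using assms(3) M by (intro member_le_sum) auto
      finally have "\<phi> K * e\<^sup>2 \<le> \<phi> K * (\<Sum>M\<in>F. ?d K M)" using nn[OF K] by (rule mult_left_mono)
      then show "\<phi> K \<le> \<phi> K * (\<Sum>M\<in>F. ?d K M) / e\<^sup>2" using assms(5) by (simp add: pos_le_divide_eq)
    qed
    also have "\<dots> \<le> (\<Sum>K\<in>?C. \<phi> K * (\<Sum>M\<in>F. ?d K M) / e\<^sup>2)"
      using fin nn by (intro sum_mono2) (auto intro!: divide_nonneg_nonneg mult_nonneg_nonneg sum_nonneg)
    also have "\<dots> = (\<Sum>M\<in>F. \<Sum>K\<in>?C. \<phi> K * ?d K M) / e\<^sup>2"
      by (simp add: sum_distrib_left sum_divide_distrib sum.swap[of _ ?C F])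
    also have "\<dots> \<le> (\<Sum>M\<in>F. real ((class_size M)\<^sup>2) / real n) / e\<^sup>2"
    proof (intro divide_right_mono sum_mono)
      fix M assume M: "M \<in> F"
      then have "M \<in> classes T (class_size M)" using assms(4) by (auto simp: classes_def)
      then show "(\<Sum>K\<in>?C. \<phi> K * ?d K M) \<le> real ((class_size M)\<^sup>2) / real n"
        using Hom_plus_variance[OF assms(1,2)] elim M by blast
    qed simp
    also have "\<dots> = C / real n / e\<^sup>2" by (simp add: C_def sum_divide_distrib)
    finally show ?case using elim by linarith
  qed
qed

text \<open>An isomorphism of the reduct is a bijection of vertices, so the whole model can be moved
  along it, and its reduct then lands exactly on \<open>A\<close>.\<close>

lemma model_with_interp_struct:
  assumes "open_interp T S I" "model S K" "struct_iso (interp_struct T I K) A" "structure_of T A"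
  obtains L where "model S L" "struct_iso K L" "interp_struct T I L = A"
proof -
  obtain f where f: "iso_by f (interp_struct T I K) A" using assms(3) struct_iso_iff by blast
  then have "inj_on f (verts K)" by (simp add: iso_by_def bij_betw_def)
  then obtain L where L: "model S L" "iso_by f K L"
    using model_transport[OF assms(2)] by blast
  have "iso_by f (interp_struct T I K) (interp_struct T I L)"
    by (rule iso_by_interp_struct[OF L(2) open_interp_fv_bounded[OF assms(1)]])
  then have "interp_struct T I L = A"
    using iso_by_unique f structure_of_interp_struct assms(4) by blast
  then show ?thesis using that L struct_iso_iff by blast
qed

text \<open>Classes of \<open>T\<close> below good classes of \<open>T1\<close> have mass above 1/2
  in the common image distribution. If no good class of \<open>T2\<close> lay over them, that mass
  would come from bad classes of \<open>T2\<close> alone, which have less than 1/2.\<close>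

lemma common_typical_class:
  assumes "finite (preds T)" "finite (preds T1)" "finite (preds T2)"
    and "open_interp T T1 I1" "open_interp T T2 I2"
    and "\<phi>1 \<in> Hom_plus T1" "\<phi>2 \<in> Hom_plus T2"
    and "pullback T T1 I1 \<phi>1 = pullback T T2 I2 \<phi>2"
    and "(\<Sum>K\<in>{K \<in> classes T1 n. \<not> P K}. \<phi>1 K) < 1 / 2"
    and "(\<Sum>K\<in>{K \<in> classes T2 n. \<not> Q K}. \<phi>2 K) < 1 / 2"
  obtains A B where "A \<in> classes T1 n" "P A" "B \<in> classes T2 n" "Q B"
    "interp_class T I1 A = interp_class T I2 B"
proof (rule ccontr)
  assume "\<not> thesis"
  then have no: "\<And>A B. A \<in> classes T1 n \<Longrightarrow> P A \<Longrightarrow> B \<in> classes T2 n \<Longrightarrow> Q B \<Longrightarrow>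
      interp_class T I1 A = interp_class T I2 B \<Longrightarrow> False"
    using that by blast
  \<comment> \<open>The indicator of the classes of \<open>T\<close> reached by good classes of
    \<open>T1\<close>, used as test function on both sides of the pullback identity.\<close>
  define u :: "struct set \<Rightarrow> real" where
    "u M = of_bool (\<exists>A\<in>classes T1 n. P A \<and> interp_class T I1 A = M)" for M
  have fin: "finite (classes T1 n)" "finite (classes T2 n)"
    using finite_classes assms(2,3) by auto
  have nn: "\<And>K. K \<in> classes T1 n \<Longrightarrow> 0 \<le> \<phi>1 K" "\<And>K. K \<in> classes T2 n \<Longrightarrow> 0 \<le> \<phi>2 K"
    using Hom_plus_nonneg assms(6,7) by blast+
  have "1 = (\<Sum>K\<in>{K \<in> classes T1 n. P K}. \<phi>1 K) + (\<Sum>K\<in>{K \<in> classes T1 n. \<not> P K}. \<phi>1 K)"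
    unfolding Hom_plus_sum[OF assms(6,2), of n, symmetric] using fin
    by (subst sum.union_disjoint[symmetric]) (auto intro!: sum.cong)
  then have "1 / 2 < (\<Sum>K\<in>{K \<in> classes T1 n. P K}. \<phi>1 K)" using assms(9) by linarith
  also have "\<dots> = (\<Sum>K\<in>{K \<in> classes T1 n. P K}. \<phi>1 K * u (interp_class T I1 K))"
    by (intro sum.cong) (auto simp: u_def)
  also have "\<dots> \<le> (\<Sum>K\<in>classes T1 n. \<phi>1 K * u (interp_class T I1 K))"
    using fin nn by (intro sum_mono2) (auto simp: u_def)
  also have "\<dots> = (\<Sum>K\<in>classes T2 n. \<phi>2 K * u (interp_class T I2 K))"
    using sum_pullback[OF assms(4,1,2), where u = u] sum_pullback[OF assms(5,1,3), where u = u]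
      assms(8) by metis
  also have "\<dots> \<le> (\<Sum>K\<in>classes T2 n. if \<not> Q K then \<phi>2 K else 0)"
  proof (rule sum_mono)
    fix K assume K: "K \<in> classes T2 n"
    show "\<phi>2 K * u (interp_class T I2 K) \<le> (if \<not> Q K then \<phi>2 K else 0)"
      using no[OF _ _ K] nn(2)[OF K] by (auto simp: u_def)
  qed
  also have "\<dots> = (\<Sum>K\<in>{K \<in> classes T2 n. \<not> Q K}. \<phi>2 K)"
    using fin by (simp add: sum.inter_filter)
  finally show False using assms(10) by linarith
qed

lemma typical_struct_iso:
  assumes "finite_model T K" "finite_model T L" "struct_iso K L" "F \<subseteq> iso_classes T"
  shows "typical \<phi> F e K \<longleftrightarrow> typical \<phi> F e L"
  using density_struct_iso[OF assms(1-3)] assms(4) by (auto simp: typical_def subset_iff)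

text \<open>The two typical models have only isomorphic reducts to \<open>T\<close>. The one of
  \<open>T2\<close> is replaced by an isomorphic copy with the same reduct as the one of
  \<open>T1\<close>; typicality survives, being isomorphism invariant, and the two can be
  amalgamated.\<close>

lemma typical_amalgam:
  assumes "canonical_theory T" "canonical_theory T1" "canonical_theory T2"
    and "open_interp T T1 I1" "open_interp T T2 I2"
    and "int_pushout T T1 T2 T' I1 I2 J1 J2"
    and "\<phi>1 \<in> Hom_plus T1" "\<phi>2 \<in> Hom_plus T2"
    and "pullback T T1 I1 \<phi>1 = pullback T T2 I2 \<phi>2"
    and "finite F1" "F1 \<subseteq> iso_classes T1" "finite F2" "F2 \<subseteq> iso_classes T2" "0 < e"
  shows "\<forall>\<^sub>F n in sequentially. \<exists>G. finite_model T' G \<and> card (verts G) = n \<and>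
    typical \<phi>1 F1 e (interp_struct T1 J1 G) \<and> typical \<phi>2 F2 e (interp_struct T2 J2 G)"
proof -
  have fin: "finite (preds T)" "finite (preds T1)" "finite (preds T2)"
    using assms(1-3) by (auto simp: canonical_theory_def)
  show ?thesis
    using atypical_measure_less_half[OF assms(7) fin(2) assms(10,11,14)]
      atypical_measure_less_half[OF assms(8) fin(3) assms(12-14)]
  proof eventually_elim
    case (elim n)
    obtain A B where A: "A \<in> classes T1 n" "typical \<phi>1 F1 e (rep A)"
      and B: "B \<in> classes T2 n" "typical \<phi>2 F2 e (rep B)"
      and AB: "interp_class T I1 A = interp_class T I2 B"
      using common_typical_class[OF fin assms(4,5,7-9) elim] by blast
    have fmA: "finite_model T1 (rep A)" and fmB: "finite_model T2 (rep B)"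
      using A B by (auto simp: classes_def finite_model_rep)
    let ?A = "interp_struct T I1 (rep A)" and ?B = "interp_struct T I2 (rep B)"
    have "?A \<in> cls T ?B"
      using AB mem_cls_self[OF finite_model_interp_struct[OF assms(4) fmA]]
      by (simp add: interp_class_def)
    then have "struct_iso ?B ?A" by (simp add: cls_def)
    then obtain L where L: "model T2 L" "struct_iso (rep B) L" "interp_struct T I2 L = ?A"
      using model_with_interp_struct[OF assms(5)] fmB structure_of_interp_struct
      by (metis finite_model_def)
    have vL: "verts L = verts (rep A)" using L(3) by (metis verts_interp_struct)
    then have fmL: "finite_model T2 L" using L(1) fmA by (simp add: finite_model_def)
    have "model T1 (rep A)" using fmA by (simp add: finite_model_def)
    then obtain G where G: "model T' G" "interp_struct T1 J1 G = rep A" "interp_struct T2 J2 G = L"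
      using pushout_amalgam[OF assms(1-6) _ L(1) L(3)[symmetric]] by blast
    have vG: "verts G = verts (rep A)" using G(2) by (metis verts_interp_struct)
    have "finite_model T' G" using G(1) vG fmA by (simp add: finite_model_def)
    moreover have "card (verts G) = n"
      using vG A(1) by (simp add: classes_def class_size_rep)
    moreover have "typical \<phi>2 F2 e L"
      using typical_struct_iso[OF fmB fmL L(2) assms(13)] B(2) by blast
    ultimately show ?case
      by (intro exI[of _ G]) (simp add: G(2,3) A(2))
  qed
qed

section \<open>Compactness\<close>

lemma bounded_real_convergent_subsequence:
  fixes f :: "nat \<Rightarrow> 'a \<Rightarrow> real"
  assumes "countable S" "\<And>n x. x \<in> S \<Longrightarrow> \<bar>f n x\<bar> \<le> B"
  obtains r where "strict_mono (r :: nat \<Rightarrow> nat)" "\<And>x. x \<in> S \<Longrightarrow> convergent (\<lambda>n. f (r n) x)"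
proof (cases "S = {}")
  case False
  let ?P = "\<lambda>i s. convergent (\<lambda>n. f (s n) (from_nat_into S i))"
  have S: "from_nat_into S i \<in> S" for i using False by (rule from_nat_into)
  interpret subseqs ?P
  proof
    fix i s
    obtain r :: "nat \<Rightarrow> nat"
      where r: "strict_mono r" "monoseq (\<lambda>n. f (s (r n)) (from_nat_into S i))"
      using seq_monosub[of "\<lambda>n. f (s n) (from_nat_into S i)"] by blast
    have "Bseq (\<lambda>n. f (s (r n)) (from_nat_into S i))"
      using assms(2)[OF S] by (intro BseqI'[of _ B]) simp
    then show "\<exists>r. strict_mono r \<and> ?P i (s \<circ> r)"
      using r Bseq_monoseq_convergent by auto
  qed
  have "convergent (\<lambda>n. f (diagseq n) x)" if "x \<in> S" for x
  proof -
    obtain i where i: "from_nat_into S i = x" using from_nat_into_surj[OF assms(1) \<open>x \<in> S\<close>] by blast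
    \<comment> \<open>Only from index \<open>Suc i\<close> on does the diagonal sequence run inside
      the subsequence chosen for the \<open>i\<close>-th element; convergence ignores the initial
      segment.\<close>
    have "?P i (diagseq \<circ> (+) (Suc i))"
    proof (rule diagseq_holds)
      fix r s n
      assume "strict_mono (r :: nat \<Rightarrow> nat)" "?P n s"
      then show "?P n (s \<circ> r)" using convergent_subseq_convergent by (fastforce simp: comp_def)
    qed
    then have "convergent (\<lambda>n. f (diagseq (n + Suc i)) x)"
      by (simp add: i add.commute)
    then show ?thesis
      using convergent_ignore_initial_segment[of "\<lambda>n. f (diagseq n) x" "Suc i"] by blast
  qed
  then show ?thesis using that subseq_diagseq by blast
qed (use that[of id] in \<open>auto simp: strict_mono_def\<close>)

text \<open>Compactness of \<open>[0,1]\<close> to a countable power: a limit of densities is a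
  functional by definition, and sizes stay strictly increasing along a subsequence.\<close>

lemma Hom_plus_subsequence:
  fixes G :: "nat \<Rightarrow> struct"
  assumes "finite (preds T)" "\<And>n. finite_model T (G n)" "strict_mono (\<lambda>n. card (verts (G n)))"
  obtains \<psi> r where "\<psi> \<in> Hom_plus T" "strict_mono r"
    "\<And>M. M \<in> iso_classes T \<Longrightarrow> (\<lambda>n. density M (G (r n))) \<longlonglongrightarrow> \<psi> M"
proof -
  have b: "0 \<le> density M (G n)" "density M (G n) \<le> 1" for M n
    using density_nonneg density_le_1 assms(2) by (auto simp: finite_model_def)
  then have "\<And>n M. M \<in> iso_classes T \<Longrightarrow> \<bar>density M (G n)\<bar> \<le> 1" by simp
  then obtain r where r: "strict_mono r" "\<And>M. M \<in> iso_classes T \<Longrightarrow> convergent (\<lambda>n. density M (G (r n)))"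
    using bounded_real_convergent_subsequence[OF countable_iso_classes[OF assms(1)],
        of "\<lambda>n M. density M (G n)" 1] by blast
  define \<psi> where "\<psi> = (\<lambda>M\<in>iso_classes T. lim (\<lambda>n. density M (G (r n))))"
  have lim: "(\<lambda>n. density M (G (r n))) \<longlonglongrightarrow> \<psi> M" if "M \<in> iso_classes T" for M
    using r(2)[OF that] that by (simp add: \<psi>_def convergent_LIMSEQ_iff)
  have "\<psi> M \<in> {0..1}" if "M \<in> iso_classes T" for M
    using LIMSEQ_le_const[OF lim[OF that], of 0] LIMSEQ_le_const2[OF lim[OF that], of 1] b by auto
  then have "\<psi> \<in> iso_classes T \<rightarrow>\<^sub>E {0..1}" by (auto simp: \<psi>_def PiE_iff)
  moreover have "strict_mono (\<lambda>n. card (verts (G (r n))))"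
    using strict_mono_o[OF assms(3) r(1)] by (simp add: comp_def)
  ultimately have "\<psi> \<in> Hom_plus T"
    using lim assms(2) unfolding Hom_plus_def
    by (intro CollectI conjI exI[of _ "\<lambda>n. G (r n)"]) auto
  then show ?thesis using that r(1) lim by blast
qed

text \<open>Densities of reducts are finite sums of densities, so taking reducts commutes with
  limits; uniqueness of limits identifies the pullback.\<close>

lemma pullback_limit:
  assumes "open_interp T S I" "finite (preds S)" "\<And>n. finite_model S (G n)"
    and "\<And>N. N \<in> iso_classes S \<Longrightarrow> (\<lambda>n. density N (G n)) \<longlonglongrightarrow> \<psi> N"
    and "\<And>M. M \<in> iso_classes T \<Longrightarrow> (\<lambda>n. density M (interp_struct T I (G n))) \<longlonglongrightarrow> \<phi> M"
    and "\<phi> \<in> Hom_plus T"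
  shows "pullback T S I \<psi> = \<phi>"
proof (rule extensionalityI[of _ "iso_classes T"])
  show "pullback T S I \<psi> \<in> extensional (iso_classes T)" by (simp add: pullback_def)
  show "\<phi> \<in> extensional (iso_classes T)" using assms(6) by (auto simp: Hom_plus_def PiE_def)
  fix M assume M: "M \<in> iso_classes T"
  then have Mc: "M \<in> classes T (class_size M)" by (simp add: classes_def)
  have "(\<lambda>n. \<Sum>N | N \<in> classes S (class_size M) \<and> interp_class T I N = M. density N (G n))
      \<longlonglongrightarrow> (\<Sum>N | N \<in> classes S (class_size M) \<and> interp_class T I N = M. \<psi> N)"
    by (intro tendsto_sum assms(4)) (auto simp: classes_def)
  then have "(\<lambda>n. density M (interp_struct T I (G n))) \<longlonglongrightarrow> pullback T S I \<psi> M"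
    by (simp add: density_interp_struct[OF assms(1-3) Mc] pullback_eq[OF assms(1) Mc])
  then show "pullback T S I \<psi> M = \<phi> M" using LIMSEQ_unique assms(5)[OF M] by blast
qed

lemma typical_convergence:
  assumes "\<And>n. typical \<phi> {M \<in> iso_classes T. class_size M \<le> n} (1 / real (Suc n)) (K n)"
    and "M \<in> iso_classes T"
  shows "(\<lambda>n. density M (K n)) \<longlonglongrightarrow> \<phi> M"
proof (rule LIM_zero_cancel)
  show "(\<lambda>n. density M (K n) - \<phi> M) \<longlonglongrightarrow> 0"
  proof (rule tendsto_0_le)
    \<comment> \<open>\<open>M\<close> is among the tested classes as soon as \<open>n\<close>
      reaches its size.\<close>
    show "\<forall>\<^sub>F n in sequentially. norm (density M (K n) - \<phi> M) \<le> norm (1 / real (Suc n)) * 1"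
      using assms unfolding typical_def
      by (intro eventually_sequentiallyI[of "class_size M"]) (auto intro: less_imp_le)
    show "(\<lambda>n. 1 / real (Suc n)) \<longlonglongrightarrow> 0"
      using LIMSEQ_inverse_real_of_nat by (simp add: inverse_eq_divide)
  qed
qed

theorem theorem5p1:
  fixes T T1 T2 T' :: thy
    and I1 I2 J1 J2 :: interp
    and \<phi>1 \<phi>2 :: "struct set \<Rightarrow> real"
  assumes "canonical_theory T" and "canonical_theory T1"
    and "canonical_theory T2" and "canonical_theory T'"
    and "open_interp T T1 I1" and "open_interp T T2 I2"
    and "int_pushout T T1 T2 T' I1 I2 J1 J2"
    and "\<phi>1 \<in> Hom_plus T1" and "\<phi>2 \<in> Hom_plus T2"
    and "pullback T T1 I1 \<phi>1 = pullback T T2 I2 \<phi>2"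
  shows "\<exists>\<psi>\<in>Hom_plus T'. pullback T1 T' J1 \<psi> = \<phi>1 \<and> pullback T2 T' J2 \<psi> = \<phi>2"
proof -
  have fin: "finite (preds T1)" "finite (preds T2)" "finite (preds T')"
    using assms(2-4) by (auto simp: canonical_theory_def)
  have J: "open_interp T1 T' J1" "open_interp T2 T' J2"
    using assms(7) by (auto simp: int_pushout_def)
  define F where "F S n = {M \<in> iso_classes S. class_size M \<le> n}" for S and n :: nat
  have "F S n = (\<Union>k\<le>n. classes S k)" for S n by (auto simp: F_def classes_def)
  then have finF: "finite (F S n)" if "finite (preds S)" for S n
    using finite_classes[OF that] by simp
  \<comment> \<open>At stage \<open>n\<close> only classes of size at most \<open>n\<close> are
    tested, a finite set as \<open>typical_amalgam\<close> requires; \<open>Suc n\<close> keeps the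
    tolerance positive at stage 0.\<close>
  define good where "good n G \<longleftrightarrow> finite_model T' G \<and>
      typical \<phi>1 (F T1 n) (1 / real (Suc n)) (interp_struct T1 J1 G) \<and>
      typical \<phi>2 (F T2 n) (1 / real (Suc n)) (interp_struct T2 J2 G)" for n G
  \<comment> \<open>The free lower bound \<open>m\<close> lets the dependent choice below produce
    strictly increasing sizes, as \<open>Hom_plus\<close> demands.\<close>
  have ex: "\<exists>G. good n G \<and> m < card (verts G)" for n m
  proof -
    have "\<forall>\<^sub>F k in sequentially. \<exists>G. finite_model T' G \<and> card (verts G) = k \<and>
        typical \<phi>1 (F T1 n) (1 / real (Suc n)) (interp_struct T1 J1 G) \<and>
        typical \<phi>2 (F T2 n) (1 / real (Suc n)) (interp_struct T2 J2 G)"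
      by (rule typical_amalgam[OF assms(1-3,5-10)]) (auto simp: F_def finF[unfolded F_def] fin)
    then have "\<forall>\<^sub>F k in sequentially. \<exists>G. good n G \<and> m < card (verts G)"
      using eventually_gt_at_top[of m] by eventually_elim (auto simp: good_def)
    then show ?thesis by simp
  qed
  obtain G where G: "\<And>n. good n (G n)" and mono: "\<And>n. card (verts (G n)) < card (verts (G (Suc n)))"
    using dependent_nat_choice[of good "\<lambda>_ A B. card (verts A) < card (verts B)"] ex by metis
  have fm: "finite_model T' (G n)" for n using G by (simp add: good_def)
  have smono: "strict_mono (\<lambda>n. card (verts (G n)))"
    using mono by (simp add: strict_mono_Suc_iff)
  obtain \<psi> r where \<psi>: "\<psi> \<in> Hom_plus T'" and r: "strict_mono r"
    and lim: "\<And>M. M \<in> iso_classes T' \<Longrightarrow> (\<lambda>n. density M (G (r n))) \<longlonglongrightarrow> \<psi> M"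
    using Hom_plus_subsequence[OF fin(3) fm smono] by blast
  have "pullback T1 T' J1 \<psi> = \<phi>1"
  proof (rule pullback_limit[OF J(1) fin(3) fm lim _ assms(8)])
    fix M assume "M \<in> iso_classes T1"
    then have "(\<lambda>n. density M (interp_struct T1 J1 (G n))) \<longlonglongrightarrow> \<phi>1 M"
      using G by (intro typical_convergence) (auto simp: good_def F_def)
    then show "(\<lambda>n. density M (interp_struct T1 J1 (G (r n)))) \<longlonglongrightarrow> \<phi>1 M"
      using LIMSEQ_subseq_LIMSEQ[OF _ r] by (fastforce simp: comp_def)
  qed
  moreover have "pullback T2 T' J2 \<psi> = \<phi>2"
  proof (rule pullback_limit[OF J(2) fin(3) fm lim _ assms(9)])
    fix M assume "M \<in> iso_classes T2"
    then have "(\<lambda>n. density M (interp_struct T2 J2 (G n))) \<longlonglongrightarrow> \<phi>2 M"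
      using G by (intro typical_convergence) (auto simp: good_def F_def)
    then show "(\<lambda>n. density M (interp_struct T2 J2 (G (r n)))) \<longlonglongrightarrow> \<phi>2 M"
      using LIMSEQ_subseq_LIMSEQ[OF _ r] by (fastforce simp: comp_def)
  qed
  ultimately show ?thesis using \<psi> by blast
qed

end
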